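(* Let $\xi_0,\xi_1,\ldots$ be nondegenerate i.i.d. complex-valued random variables with $\mathbb{E}\log(1+|\xi_0|)<\infty$. Let $w_0,w_1,\ldots\in\mathbb{C}\setminus\{0\}$ be a deterministic sequence such that $\lim_{k\to\infty}\frac1k\log|w_k|=w$ for some constant $w\in\mathbb{R}$, and let $\mathbf{W}_n(z)=\sum_{k=0}^n\xi_kw_kz^k$. Then, as $n\to\infty$, the sequence of random measures $\frac1n\mu_{\mathbf{W}_n}$ on $\mathbb{C}$ converges in probability to the uniform probability distribution on the circle of radius $e^{-w}$ centered at the origin.
   Context: "Nondegenerate" means not a.s. constant. For an entire function $G$ not identically zero, $\mu_G=\sum_{z\in\mathbb{C}: G(z)=0}n_G(z)\,\delta(z)$, where $n_G(z)$ is the multiplicity of the zero $z$ and $\delta(z)$ is the unit mass at $z$; if $G\equiv 0$, then $\mu_G=0$. Locally finite measures on $\mathbb{C}$ are endowed with the vague topology (convergence of integrals of continuous compactly supported functions). Random measures $\nu_n$ converge to $\nu$ in probability if $\int_{\mathbb{C}}\varphi\,d\nu_n\to\int_{\mathbb{C}}\varphi\,d\nu$ in probability for every continuous compactly supported $\varphi:\mathbb{C}\to\mathbb{R}$. *)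

theory Defs
  imports "HOL-Probability.Probability" "HOL-Complex_Analysis.Complex_Analysis"
begin

text \<open>
  The measure of zeros, counted with multiplicity: \<open>density (count_space _)\<close> is the purely atomic
  measure on the zero set with mass \<open>zorder G z\<close> at \<open>z\<close>, and \<open>distr\<close> transports it to the Borel
  sets of the plane.  Intended for entire \<open>G\<close>; the case distinction is needed because \<open>zorder\<close> is
  meaningless for the zero function.
\<close>

definition zero_measure :: "(complex \<Rightarrow> complex) \<Rightarrow> complex measure" where
  "zero_measure G =
     (if \<forall>z. G z = 0 then null_measure borel
      else distr (density (count_space {z. G z = 0}) (\<lambda>z. ennreal (of_int (zorder G z))))
                 borel (\<lambda>z. z))"

definition test_function :: "(complex \<Rightarrow> real) \<Rightarrow> bool" where
  "test_function \<phi> \<longleftrightarrow> continuous_on UNIV \<phi> \<and> compact (closure {z. \<phi> z \<noteq> 0})"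

text \<open>
  A random locally finite measure on the plane.  Measurability for the Borel sigma-algebra of the
  vague topology amounts to measurability of all integrals of test functions.
\<close>

definition random_measure :: "'a measure \<Rightarrow> ('a \<Rightarrow> complex measure) \<Rightarrow> bool" where
  "random_measure M \<nu> \<longleftrightarrow>
     (\<forall>\<omega>\<in>space M. sets (\<nu> \<omega>) = sets borel \<and> (\<forall>K. compact K \<longrightarrow> emeasure (\<nu> \<omega>) K < \<infinity>)) \<and>
     (\<forall>\<phi>. test_function \<phi> \<longrightarrow> (\<lambda>\<omega>. integral\<^sup>L (\<nu> \<omega>) \<phi>) \<in> borel_measurable M)"

text \<open>
  Measurability is part of the two notions of convergence: \<open>measure M\<close> is \<open>0\<close> on non-measurable
  sets, so that the limit relation alone would be meaningless without it.
\<close>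

definition converges_in_probability ::
    "'a measure \<Rightarrow> (nat \<Rightarrow> 'a \<Rightarrow> real) \<Rightarrow> ('a \<Rightarrow> real) \<Rightarrow> bool" where
  "converges_in_probability M X Y \<longleftrightarrow>
     (\<forall>n. X n \<in> borel_measurable M) \<and> Y \<in> borel_measurable M \<and>
     (\<forall>\<epsilon>>0. (\<lambda>n. measure M {\<omega> \<in> space M. \<bar>X n \<omega> - Y \<omega>\<bar> > \<epsilon>}) \<longlonglongrightarrow> 0)"

definition measures_converge_in_probability ::
    "'a measure \<Rightarrow> (nat \<Rightarrow> 'a \<Rightarrow> complex measure) \<Rightarrow> ('a \<Rightarrow> complex measure) \<Rightarrow> bool" where
  "measures_converge_in_probability M \<nu> \<nu>' \<longleftrightarrow>
     (\<forall>n. random_measure M (\<nu> n)) \<and> random_measure M \<nu>' \<and>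
     (\<forall>\<phi>. test_function \<phi> \<longrightarrow>
        converges_in_probability M (\<lambda>n \<omega>. integral\<^sup>L (\<nu> n \<omega>) \<phi>) (\<lambda>\<omega>. integral\<^sup>L (\<nu>' \<omega>) \<phi>))"

definition uniform_circle :: "real \<Rightarrow> complex measure" where
  "uniform_circle r =
     distr (uniform_measure lborel {0..2*pi}) borel (\<lambda>t. complex_of_real r * cis t)"

definition random_polynomial ::
    "(nat \<Rightarrow> 'a \<Rightarrow> complex) \<Rightarrow> (nat \<Rightarrow> complex) \<Rightarrow> nat \<Rightarrow> 'a \<Rightarrow> complex \<Rightarrow> complex" where
  "random_polynomial \<xi> w n \<omega> z = (\<Sum>k\<le>n. \<xi> k \<omega> * w k * z ^ k)"

end

theory Submission
  imports Defs "HOL-Computational_Algebra.Computational_Algebra" "HOL-Real_Asymp.Real_Asymp"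
begin

text \<open>
  Rescale so that the limit circle is the unit circle, and let \<open>p\<close> be the rescaled polynomial. With probability
  tending to one all coefficients of \<open>p\<close> are at most \<open>exp (\<epsilon> n)\<close> and, as \<open>\<xi>\<close> is not almost surely \<open>0\<close>, some
  coefficient of index at most \<open>\<epsilon> n\<close> and some coefficient of index at least \<open>(1 - \<epsilon>) n\<close> is at least
  \<open>exp (- \<epsilon> n)\<close>. The rest is deterministic. With roots \<open>z\<^sub>j\<close> and leading coefficient \<open>c\<close>, the quantity
  \<open>\<bar>c\<bar> \<Prod> max R \<bar>z\<^sub>j\<bar>\<close> is at most the maximum of \<open>\<bar>p\<bar>\<close> on the circle of radius \<open>R\<close> and, by Vieta, at least each
  coefficient times \<open>R ^ k\<close> up to a binomial factor; hence its logarithm is \<open>n max 0 (ln R) + o(n)\<close>. Comparing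
  \<open>R = 1/2, 1, 2\<close> shows that all but \<open>o(n)\<close> roots are close to the unit circle. For the arguments, reflect
  the roots into the unit disc: \<open>\<Prod> (1 - \<zeta>\<^sub>j x)\<close> is at most \<open>exp (o(n))\<close> in the disc, so by Borel-Caratheodory
  all coefficients of its logarithm, that is, all power sums of the \<open>\<zeta>\<^sub>j\<close>, are \<open>o(n)\<close>. The theorem of
  Stone and Weierstrass passes from powers to continuous functions on the circle.
\<close>

section \<open>Polynomials and their roots on circles\<close>

text \<open>By Vieta, for \<open>k \<le> d\<close> the coefficient is up to sign a sum of
  \<open>d choose k\<close> products of \<open>d - k\<close> roots, and \<open>R ^ k\<close> times
  each of these is bounded by the product on the right. The induction multiplies in one linear
  factor at a time and ends with Pascal's rule.\<close>

lemma norm_coeff_prod_linear_le: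
  fixes z :: "nat \<Rightarrow> complex"
  assumes "R > 0"
  shows "R ^ k * norm (coeff (\<Prod>j<d. [:- z j, 1:]) k)
           \<le> real (d choose k) * (\<Prod>j<d. max R (norm (z j)))"
proof (induction d arbitrary: k)
  case 0
  show ?case by (cases k) auto
next
  case (Suc d)
  define q where "q = (\<Prod>j<d. [:- z j, 1:])"
  define m where "m = (\<Prod>j<d. max R (norm (z j)))"
  have m: "m \<ge> 0" unfolding m_def using assms by (intro prod_nonneg) auto
  have IH: "R ^ k * norm (coeff q k) \<le> real (d choose k) * m" for k
    using Suc.IH by (simp add: q_def m_def)
  have q: "(\<Prod>j<Suc d. [:- z j, 1:]) = pCons 0 q - smult (z d) q"
    by (simp add: q_def mult.commute)
  have M: "(\<Prod>j<Suc d. max R (norm (z j))) = m * max R (norm (z d))"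
    by (simp add: m_def)
  have a: "norm (z d) * (real (d choose i) * m) \<le> max R (norm (z d)) * (real (d choose i) * m)" 
    "R * (real (d choose i) * m) \<le> max R (norm (z d)) * (real (d choose i) * m)" for i
    using m by (auto intro!: mult_right_mono)
  have b: "R ^ i * (norm (z d) * norm (coeff q i)) \<le> norm (z d) * (real (d choose i) * m)" for i
    using mult_left_mono[OF IH[of i], of "norm (z d)"] by (simp add: mult_ac)
  show ?case
  proof (cases k)
    case 0
    then show ?thesis unfolding q M using a[of 0] b[of 0] by (simp add: norm_mult mult_ac)
  next
    case (Suc i)
    have "R ^ k * norm (coeff (pCons 0 q - smult (z d) q) k)
        \<le> R ^ k * (norm (coeff q i) + norm (z d) * norm (coeff q k))"
      using assms Suc by (intro mult_left_mono) (auto intro: order_trans[OF norm_triangle_ineq4] simp: norm_mult)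
    also have "\<dots> = R * (R ^ i * norm (coeff q i)) + R ^ k * (norm (z d) * norm (coeff q k))"
      by (simp add: Suc algebra_simps)
    also have "\<dots> \<le> R * (real (d choose i) * m) + norm (z d) * (real (d choose k) * m)"
      using b[of k] IH[of i] assms by (intro add_mono) auto
    also have "\<dots> \<le> max R (norm (z d)) * (real (d choose i) * m) + max R (norm (z d)) * (real (d choose k) * m)"
      using a by (intro add_mono) auto
    finally show ?thesis unfolding q M by (simp add: Suc algebra_simps)
  qed
qed

text \<open>
  Reflecting the roots inside the circle changes neither the modulus on the circle nor \<open>B\<close>, but makes
  the value at \<open>0\<close> equal to the left-hand side; this replaces Jensen's formula.
\<close>

lemma prod_max_norm_roots_le:
  fixes z :: "nat \<Rightarrow> complex"
  assumes R: "R > 0" and B: "\<And>x. norm x = R \<Longrightarrow> norm (c * (\<Prod>j<d. x - z j)) \<le> B"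
  shows "norm c * (\<Prod>j<d. max R (norm (z j))) \<le> B"
proof -
  define h where "h j x = (if norm (z j) \<le> R then of_real R - cnj (z j) * x / of_real R else z j - x)" for j x
  define H where "H x = c * (\<Prod>j<d. h j x)" for x
  have "h j holomorphic_on A" for j A
    unfolding h_def using R by (cases "norm (z j) \<le> R") (auto intro!: holomorphic_intros)
  then have hol: "H holomorphic_on A" for A
    unfolding H_def by (intro holomorphic_intros)
  have nh: "norm (h j x) = norm (x - z j)" if "norm x = R" for j x
  proof (cases "norm (z j) \<le> R")
    case True
    have xx: "x * cnj x = of_real R * of_real R"
      by (metis complex_norm_square of_real_mult power2_eq_square that)
    have "norm (h j x) = norm (cnj (h j x))" by simp
    also have "cnj (h j x) = of_real R - z j * cnj x / of_real R" using True by (simp add: h_def)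
    also have "\<dots> = cnj x * (x - z j) / of_real R"
      using xx R by (simp add: field_simps)
    also have "norm \<dots> = norm (x - z j)" using that R by (simp add: norm_mult norm_divide)
    finally show ?thesis .
  qed (simp add: h_def norm_minus_commute)
  have h0: "norm (h j 0) = max R (norm (z j))" for j
    using R by (auto simp: h_def max_def)
  have "norm (H 0) \<le> B"
  proof (rule maximum_modulus_frontier[of H "ball 0 R"])
    show "H holomorphic_on interior (ball 0 R)" by (rule hol)
    show "continuous_on (closure (ball 0 R)) H" by (intro holomorphic_on_imp_continuous_on hol)
    show "norm (H x) \<le> B" if "x \<in> frontier (ball 0 R)" for x
    proof -
      have x: "norm x = R" using that R by (simp add: frontier_ball)
      have "norm (H x) = norm (c * (\<Prod>j<d. x - z j))"
        using nh[OF x] by (simp add: H_def norm_mult prod_norm[symmetric])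
      then show ?thesis using B[OF x] by simp
    qed
  qed (use R in auto)
  moreover have "norm (H 0) = norm c * (\<Prod>j<d. max R (norm (z j)))"
    by (simp add: H_def norm_mult prod_norm[symmetric] h0)
  ultimately show ?thesis by simp
qed

section \<open>From bounds on products over the circle to bounds on power sums\<close>

lemma prod_one_minus_roots_of_unity:
  fixes x :: complex
  assumes "m > 0"
  shows "(\<Prod>u | u ^ m = 1. 1 - u * x) = 1 - x ^ m"
proof (cases "x = 0")
  case True
  then show ?thesis using assms by simp
next
  case False
  define p :: "complex poly" where "p = monom 1 m - 1"
  have ev: "poly p z = z ^ m - 1" for z by (simp add: p_def poly_monom)
  have "degree p = m"
    using assms by (intro antisym degree_le le_degree) (auto simp: p_def coeff_1)
  then have lc: "lead_coeff p = 1" using assms by (simp add: p_def)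
  have "rsquarefree p"
    unfolding rsquarefree_roots
    using assms by (auto simp: ev p_def pderiv_diff pderiv_monom poly_monom power_0_left)
  then have "p = (\<Prod>z | poly p z = 0. [:- z, 1:])"
    using complex_poly_decompose_rsquarefree[of p] lc by simp
  \<comment> \<open>Evaluating the factorization of \<open>X ^ m - 1\<close> at \<open>1 / x\<close>
    and clearing one \<open>x\<close> from each of the \<open>m\<close> factors yields the reversed
    polynomial \<open>1 - x ^ m\<close>.\<close>
  then have "poly p (1 / x) = poly (\<Prod>z | poly p z = 0. [:- z, 1:]) (1 / x)" by simp
  also have "\<dots> = (\<Prod>u | u ^ m = 1. 1 / x - u)" by (simp add: poly_prod ev)
  also have "\<dots> = (\<Prod>u | u ^ m = 1. (1 - u * x) / x)" using False by (simp add: field_simps)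
  also have "\<dots> = (\<Prod>u | u ^ m = 1. 1 - u * x) / x ^ m"
    using card_complex_roots_unity[of m] assms by (simp add: prod_dividef)
  finally show ?thesis using False by (simp add: ev field_simps)
qed

text \<open>The Schwarz lemma applies to \<open>h / (2 * A - h)\<close>, which maps the unit disc into itself.\<close>

lemma norm_deriv_le_of_Re_le:
  assumes hol: "h holomorphic_on ball 0 1" and h0: "h 0 = 0" and A: "A > 0"
    and Re: "\<And>x. norm x < 1 \<Longrightarrow> Re (h x) \<le> A"
  shows "norm (deriv h 0) \<le> 2 * A"
proof -
  define f where "f x = h x / (2 * of_real A - h x)" for x
  have nz: "2 * of_real A - h x \<noteq> 0" if "norm x < 1" for x
  proof
    assume "2 * of_real A - h x = 0"
    then have "Re (2 * of_real A - h x) = 0" by simp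
    then show False using Re[OF that] A by simp
  qed
  have fle: "norm (f x) \<le> 1" if "norm x < 1" for x
  proof -
    \<comment> \<open>The right square exceeds the left one by
      \<open>4 * A * (A - Re (h x))\<close>.\<close>
    have "(norm (h x))\<^sup>2 \<le> (norm (2 * of_real A - h x))\<^sup>2"
      unfolding cmod_power2 using mult_left_mono[OF Re[OF that], of "4 * A"] A
      by (simp add: power2_eq_square algebra_simps)
    then have "norm (h x) \<le> norm (2 * of_real A - h x)"
      by (rule power2_le_imp_le) simp
    then show ?thesis using nz[OF that] by (simp add: f_def norm_divide divide_le_eq_1)
  qed
  have folh: "f holomorphic_on ball 0 1"
    unfolding f_def using nz by (auto intro!: holomorphic_intros hol)
  \<comment> \<open>The Schwarz lemma wants values strictly inside the disc, whereas
    \<open>f\<close> is only known to satisfy the weak bound; hence the division by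
    \<open>1 + e\<close> for arbitrary \<open>e > 0\<close>.\<close>
  have "norm (deriv f 0) \<le> 1"
  proof (rule field_le_epsilon, goal_cases)
    case (1 e)
    have n: "norm (1 + complex_of_real e) = 1 + e"
      using 1 by (metis abs_of_pos add_pos_pos norm_of_real of_real_1 of_real_add zero_less_one)
    have "norm (deriv (\<lambda>x. f x / (1 + e)) 0) \<le> 1"
    proof (rule Schwarz_Lemma(2)[where \<xi>=0])
      show "(\<lambda>x. f x / (1 + e)) holomorphic_on ball 0 1"
        using 1 by (auto intro!: holomorphic_intros folh simp: complex_eq_iff)
      show "norm (f x / (1 + e)) < 1" if "norm x < 1" for x
        using fle[OF that] 1 by (simp add: norm_divide n)
    qed (simp_all add: f_def h0)
    moreover have "deriv (\<lambda>x. f x / (1 + e)) 0 = deriv f 0 / (1 + e)"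
      using holomorphic_on_imp_differentiable_at[OF folh] 1 by (intro deriv_cdivide_right) auto
    ultimately show ?case
      using 1 by (simp add: norm_divide n divide_le_eq)
  qed
  moreover have "deriv f 0 = deriv h 0 / (2 * A)"
  proof (rule DERIV_imp_deriv)
    have "(h has_field_derivative deriv h 0) (at 0)"
      using hol by (intro holomorphic_derivI[where S="ball 0 1"]) auto
    then show "(f has_field_derivative deriv h 0 / (2 * A)) (at 0)"
      unfolding f_def using A h0 by (auto intro!: derivative_eq_intros simp: field_simps)
  qed
  ultimately show ?thesis using A by (simp add: norm_divide norm_mult field_simps)
qed

text \<open>The sum is \<open>- deriv h 0\<close> for the logarithm \<open>h\<close> of the product.
  Each factor has positive real part in the open disc, so the principal branch is holomorphic there;
  the maximum principle carries the bound on the circle inside, where it becomes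
  \<open>Re (h x) \<le> A\<close>.\<close>

lemma norm_sum_le_of_norm_prod_le:
  fixes y :: "nat \<Rightarrow> complex"
  assumes y: "\<And>j. j < d \<Longrightarrow> norm (y j) \<le> 1" and A: "A > 0"
    and B: "\<And>x. norm x = 1 \<Longrightarrow> norm (\<Prod>j<d. 1 - y j * x) \<le> exp A"
  shows "norm (\<Sum>j<d. y j) \<le> 2 * A"
proof -
  define h where "h x = (\<Sum>j<d. Ln (1 - y j * x))" for x
  have yx: "norm (y j * x) < 1" if "j < d" "norm x < 1" for j x
    using y[OF that(1)] that(2) by (simp add: norm_mult) (metis mult_left_le_one_le mult.commute norm_ge_zero order_le_less_trans)
  have Re: "Re (1 - y j * x) > 0" if "j < d" "norm x < 1" for j x
    using yx[OF that] complex_Re_le_cmod[of "y j * x"] by simp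
  then have nn: "1 - y j * x \<notin> \<real>\<^sub>\<le>\<^sub>0" if "j < d" "norm x < 1" for j x
    using that by (metis complex_nonpos_Reals_iff not_le)
  have "norm (deriv h 0) \<le> 2 * A"
  proof (rule norm_deriv_le_of_Re_le)
    show "h holomorphic_on ball 0 1"
      unfolding h_def using nn by (auto intro!: holomorphic_intros)
    show "Re (h x) \<le> A" if x: "norm x < 1" for x
    proof -
      have nz: "1 - y j * x \<noteq> 0" if "j < d" for j using Re[OF that x] by (metis less_irrefl zero_complex.sel(1))
      have "norm (\<Prod>j<d. 1 - y j * x) \<le> exp A"
      proof (rule maximum_modulus_frontier[of "\<lambda>u. \<Prod>j<d. 1 - y j * u" "ball 0 1"])
        show "norm (\<Prod>j<d. 1 - y j * u) \<le> exp A" if "u \<in> frontier (ball 0 1)" for u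
          using that by (intro B) (simp add: frontier_ball)
      qed (use x in \<open>simp_all add: holomorphic_intros continuous_intros\<close>)
      moreover have "exp (h x) = (\<Prod>j<d. 1 - y j * x)"
        unfolding h_def using nz by (simp add: exp_sum)
      ultimately show ?thesis by (metis exp_le_cancel_iff norm_exp_eq_Re)
    qed
  qed (use A in \<open>simp_all add: h_def\<close>)
  moreover have "deriv h 0 = - (\<Sum>j<d. y j)"
    unfolding h_def by (rule DERIV_imp_deriv)
      (auto intro!: derivative_eq_intros sum.cong simp: sum_negf[symmetric])
  ultimately show ?thesis by simp
qed

text \<open>
  Multiplying over the \<open>m\<close>-th roots of unity replaces each \<open>y j\<close> by \<open>y j ^ m\<close>, at the price of a factor
  \<open>m\<close> in the exponent.
\<close>

lemma norm_power_sum_le_of_norm_prod_le: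
  fixes y :: "nat \<Rightarrow> complex"
  assumes y: "\<And>j. j < d \<Longrightarrow> norm (y j) \<le> 1" and A: "A > 0" and m: "m > 0"
    and B: "\<And>x. norm x = 1 \<Longrightarrow> norm (\<Prod>j<d. 1 - y j * x) \<le> exp A"
  shows "norm (\<Sum>j<d. y j ^ m) \<le> 2 * m * A"
proof -
  have "norm (\<Sum>j<d. y j ^ m) \<le> 2 * (m * A)"
  proof (rule norm_sum_le_of_norm_prod_le)
    show "norm (\<Prod>j<d. 1 - y j ^ m * x) \<le> exp (m * A)" if "norm x = 1" for x
    proof -
      \<comment> \<open>Any root \<open>t\<close> will do: it lies on the unit circle, and so do all
        \<open>u * t\<close>, where the hypothesis \<open>B\<close> applies.\<close>
      obtain t where t: "t ^ m = x"
        using m by (metis exists_complex_root bot_nat_0.not_eq_extremum)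
      have nu: "norm u = 1" if "norm (u ^ m) = 1" for u :: complex
        using that m power_eq_imp_eq_base[of "norm u" m 1] by (simp add: norm_power)
      have nt: "norm t = 1" using that t nu by metis
      have "(\<Prod>j<d. 1 - y j ^ m * x) = (\<Prod>j<d. \<Prod>u | u ^ m = 1. 1 - u * (y j * t))"
        using m t by (simp add: prod_one_minus_roots_of_unity power_mult_distrib)
      also have "\<dots> = (\<Prod>u | u ^ m = 1. \<Prod>j<d. 1 - y j * (u * t))"
        by (subst prod.swap) (simp add: mult_ac)
      finally have "norm (\<Prod>j<d. 1 - y j ^ m * x) = (\<Prod>u | u ^ m = 1. norm (\<Prod>j<d. 1 - y j * (u * t)))"
        by (simp add: prod_norm)
      also have "\<dots> \<le> (\<Prod>u::complex | u ^ m = 1. exp A)"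
        using nt nu by (intro prod_mono) (auto intro!: B simp: norm_mult)
      also have "\<dots> = exp (m * A)"
        using card_complex_roots_unity[of m] m by (simp add: exp_of_nat_mult)
      finally show ?thesis .
    qed
  qed (use A m y in \<open>auto simp: norm_power power_le_one\<close>)
  then show ?thesis by simp
qed

section \<open>Coefficient bounds and root asymptotics\<close>

text \<open>A single term of the expansion of \<open>(1 + x) ^ n\<close> is at most
  \<open>exp (x * n)\<close>. For small fixed \<open>x\<close> and \<open>k\<close> small compared
  to \<open>n\<close>, the binomial coefficient is therefore subexponential.\<close>

lemma ln_binomial_le:
  fixes x :: real
  assumes x: "0 < x" and k: "k \<le> n"
  shows "ln (real (n choose k)) \<le> x * n + k * ln (1 / x)"
proof -
  have pos: "real (n choose k) > 0" using k by (simp add: zero_less_binomial)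
  have "real (n choose k) * x ^ k \<le> (\<Sum>i\<le>n. real (n choose i) * x ^ i)"
    using x k by (intro member_le_sum[of k]) auto
  also have "\<dots> = (x + 1) ^ n" by (simp add: binomial_ring)
  also have "\<dots> \<le> exp x ^ n"
    using x exp_ge_add_one_self[of x] by (intro power_mono) (auto simp: add.commute)
  also have "\<dots> = exp (x * n)" by (simp add: exp_of_nat2_mult)
  finally have "ln (real (n choose k) * x ^ k) \<le> ln (exp (x * n))"
    using pos x by (subst ln_le_cancel_iff) auto
  then show ?thesis using pos x by (simp add: ln_mult ln_realpow ln_div)
qed

lemma ln_Suc_over_tendsto_0: "(\<lambda>n. ln (real n + 1) / real n) \<longlonglongrightarrow> 0"
  by real_asymp

text \<open>The deterministic setting, with roots already rescaled to the unit circle. The index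
  \<open>i\<close> is kept apart from the degree bound \<open>n i\<close> because the probabilistic
  argument later feeds in a sequence of pairs of a degree bound and a sample point. The true degree
  may be below \<open>n i\<close>, and \<open>c i = 0\<close> is excluded only eventually, by
  \<open>coeff_low\<close>.\<close>

locale root_asymptotics =
  fixes F :: "'i filter" and n d :: "'i \<Rightarrow> nat" and c :: "'i \<Rightarrow> complex" and z :: "'i \<Rightarrow> nat \<Rightarrow> complex"
    and P :: "'i \<Rightarrow> complex poly"
  defines "P \<equiv> \<lambda>i. smult (c i) (\<Prod>j<d i. [:- z i j, 1:])"
  assumes n_at_top: "filterlim n at_top F"
    and deg_le: "\<And>i. d i \<le> n i"
    and coeff_upper: "\<And>\<epsilon>::real. \<epsilon> > 0 \<Longrightarrow> \<forall>\<^sub>F i in F. \<forall>k. norm (coeff (P i) k) \<le> exp (\<epsilon> * n i)"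
    and coeff_low: "\<And>\<epsilon>::real. \<epsilon> > 0 \<Longrightarrow>
      \<forall>\<^sub>F i in F. \<exists>k. real k \<le> \<epsilon> * n i \<and> exp (- \<epsilon> * n i) \<le> norm (coeff (P i) k)"
    and coeff_high: "\<And>\<epsilon>::real. \<epsilon> > 0 \<Longrightarrow>
      \<forall>\<^sub>F i in F. \<exists>k. (1 - \<epsilon>) * n i \<le> real k \<and> exp (- \<epsilon> * n i) \<le> norm (coeff (P i) k)"
begin

text \<open>The Mahler measure of \<open>P i\<close> on the circle of radius \<open>R\<close>: for
  \<open>c i \<noteq> 0\<close> and \<open>R > 0\<close>, Jensen's formula makes its logarithm the
  mean of \<open>ln (norm (poly (P i) x))\<close> over that circle.\<close>

definition mahler :: "real \<Rightarrow> 'i \<Rightarrow> real" where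
  "mahler R i = norm (c i) * (\<Prod>j<d i. max R (norm (z i j)))"

lemma degree_prod_roots: "degree (\<Prod>j<k. [:- z i j, 1:]) = k"
  by (subst degree_prod_sum_eq) auto

lemma coeff_P_eq_0: "k > d i \<Longrightarrow> coeff (P i) k = 0"
  by (simp add: P_def coeff_eq_0 degree_prod_roots)

lemma coeff_P_nonzeroD:
  assumes "exp a \<le> norm (coeff (P i) k)" shows "k \<le> d i" "c i \<noteq> 0"
proof -
  have "coeff (P i) k \<noteq> 0" using assms by (metis exp_gt_zero not_le norm_zero)
  then show "k \<le> d i" "c i \<noteq> 0" using coeff_P_eq_0[of i k] by (auto simp: P_def not_less[symmetric])
qed

lemma poly_P: "poly (P i) x = c i * (\<Prod>j<d i. x - z i j)"
  by (simp add: P_def poly_prod)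

lemma eventually_n_pos: "\<forall>\<^sub>F i in F. n i > 0"
  using n_at_top eventually_compose_filterlim eventually_gt_at_top by blast

lemma eventually_c_nonzero: "\<forall>\<^sub>F i in F. c i \<noteq> 0"
  using coeff_low[OF zero_less_one] by eventually_elim (auto dest: coeff_P_nonzeroD)

lemma mahler_pos: "c i \<noteq> 0 \<Longrightarrow> R > 0 \<Longrightarrow> mahler R i > 0"
  unfolding mahler_def by (intro mult_pos_pos prod_pos) (auto simp: less_max_iff_disj)

lemma ln_mahler:
  assumes "c i \<noteq> 0" "R > 0"
  shows "ln (mahler R i) = ln (norm (c i)) + (\<Sum>j<d i. ln (max R (norm (z i j))))"
  using assms unfolding mahler_def 
  by (subst ln_mult_pos) (auto simp: less_max_iff_disj ln_prod intro!: prod_pos)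

text \<open>The three summands in the exponent stem from the number of terms, the size of the
  coefficients and the largest power of \<open>R\<close>.\<close>

lemma eventually_poly_le:
  fixes \<epsilon> R :: real
  assumes "\<epsilon> > 0" "R > 0"
  shows "\<forall>\<^sub>F i in F. \<forall>x. norm x = R \<longrightarrow>
           norm (poly (P i) x) \<le> exp (ln (n i + 1) + \<epsilon> * n i + n i * max 0 (ln R))"
  using coeff_upper[OF \<open>\<epsilon> > 0\<close>]
proof eventually_elim
  case (elim i)
  have mR: "exp (n i * max 0 (ln R)) = max 1 R ^ n i"
    using assms by (cases "R \<le> 1") (simp_all add: exp_of_nat_mult max_def)
  show ?case
  proof (intro allI impI)
    fix x :: complex assume x: "norm x = R"
    have "norm (poly (P i) x) \<le> (\<Sum>k\<le>d i. norm (coeff (P i) k * x ^ k))"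
    proof -
      have "poly (P i) x = (\<Sum>k\<le>d i. coeff (P i) k * x ^ k)"
        unfolding poly_altdef using coeff_P_eq_0[of i]
        by (intro sum.mono_neutral_left) (auto simp: coeff_eq_0 intro!: degree_le)
      then show ?thesis by (simp add: norm_sum)
    qed
    also have "\<dots> \<le> (\<Sum>k\<le>d i. exp (\<epsilon> * n i) * max 1 R ^ n i)"
    proof (intro sum_mono)
      fix k assume k: "k \<in> {..d i}"
      have "R ^ k \<le> max 1 R ^ k" using assms by (intro power_mono) auto
      also have "\<dots> \<le> max 1 R ^ n i" using k deg_le[of i] by (intro power_increasing) auto
      finally show "norm (coeff (P i) k * x ^ k) \<le> exp (\<epsilon> * n i) * max 1 R ^ n i"
        using elim x assms by (auto simp: norm_mult norm_power intro!: mult_mono)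
    qed
    also have "\<dots> = (d i + 1) * (exp (\<epsilon> * n i) * max 1 R ^ n i)" by simp
    also have "\<dots> \<le> (n i + 1) * (exp (\<epsilon> * n i) * max 1 R ^ n i)"
      using deg_le[of i] by (intro mult_right_mono) auto
    also have "\<dots> = exp (ln (n i + 1) + \<epsilon> * n i + n i * max 0 (ln R))"
      unfolding exp_add mR by simp
    finally show "norm (poly (P i) x) \<le> exp (ln (n i + 1) + \<epsilon> * n i + n i * max 0 (ln R))" .
  qed
qed

text \<open>The upper bound is the maximum of the polynomial on the circle. The lower bound comes
  from a single coefficient through Vieta: one of low index if \<open>R \<le> 1\<close>, one of high
  index if \<open>R > 1\<close>.\<close>

lemma ln_mahler_tendsto:
  assumes R: "R > 0"
  shows "((\<lambda>i. ln (mahler R i) / n i) \<longlongrightarrow> max 0 (ln R)) F"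
proof (rule tendstoI)
  fix \<eta> :: real assume "\<eta> > 0"
  \<comment> \<open>\<open>x\<close> is the free parameter of \<open>ln_binomial_le\<close>.
    \<open>L\<close> collects the factors by which \<open>\<epsilon> * n i\<close> enters the lower
    bound: \<open>\<bar>ln R\<bar>\<close> from the position of the coefficient, \<open>1\<close>
    from its size and \<open>ln (1 / x)\<close> from the binomial coefficient. Thus
    \<open>\<epsilon> * L = \<eta> / 4\<close>.\<close>
  define x where "x = min 1 (\<eta> / 4)"
  define L where "L = \<bar>ln R\<bar> + 1 + ln (1 / x)"
  define \<epsilon> where "\<epsilon> = \<eta> / 4 / L"
  have x: "0 < x" "x \<le> 1" "x \<le> \<eta> / 4" using \<open>\<eta> > 0\<close> by (auto simp: x_def)
  then have lx: "ln (1 / x) \<ge> 0" by simp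
  then have L: "L \<ge> 1" by (simp add: L_def)
  then have \<epsilon>: "\<epsilon> > 0" "\<epsilon> * L = \<eta> / 4" "\<epsilon> \<le> \<eta> / 4" 
    using \<open>\<eta> > 0\<close> by (auto simp: \<epsilon>_def divide_le_eq)
  \<comment> \<open>The index \<open>k'\<close> is \<open>k\<close> itself in the low case and
    \<open>d i - k\<close> in the high case. Either way it is small, and the symmetry of binomial
    coefficients lets it replace \<open>k\<close>.\<close>
  have key: "\<forall>\<^sub>F i in F. \<exists>k k'. real k' \<le> \<epsilon> * n i \<and> k' \<le> d i \<and> d i choose k = d i choose k' \<and>
      exp (- \<epsilon> * n i) \<le> norm (coeff (P i) k) \<and> n i * max 0 (ln R) - \<epsilon> * n i * \<bar>ln R\<bar> \<le> k * ln R"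
  proof (cases "R \<le> 1")
    case True
    then have lnR: "ln R \<le> 0" using R by simp
    from coeff_low[OF \<epsilon>(1)] show ?thesis
    proof eventually_elim
      case (elim i)
      then obtain k where k: "real k \<le> \<epsilon> * n i" "exp (- \<epsilon> * n i) \<le> norm (coeff (P i) k)" by auto
      show ?case
        using k coeff_P_nonzeroD[OF k(2)] lnR mult_right_mono_neg[OF k(1) lnR] by (intro exI[of _ k]) auto
    qed
  next
    case False
    then have lnR: "ln R \<ge> 0" by simp
    from coeff_high[OF \<epsilon>(1)] show ?thesis
    proof eventually_elim
      case (elim i)
      then obtain k where k: "(1 - \<epsilon>) * n i \<le> real k" "exp (- \<epsilon> * n i) \<le> norm (coeff (P i) k)" by auto
      have kd: "k \<le> d i" using coeff_P_nonzeroD[OF k(2)] by simp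
      show ?case
        using k kd lnR mult_right_mono[OF k(1) lnR] deg_le[of i] binomial_symmetric[OF kd]
        by (intro exI[of _ k] exI[of _ "d i - k"]) (auto simp: of_nat_diff algebra_simps)
    qed
  qed
  have "\<forall>\<^sub>F i in F. ln (real (n i) + 1) / real (n i) < \<eta> / 4"
    using order_tendstoD(2)[OF filterlim_compose[OF ln_Suc_over_tendsto_0 n_at_top], of "\<eta> / 4"] \<open>\<eta> > 0\<close> by simp
  with key eventually_poly_le[OF \<epsilon>(1) R] eventually_n_pos eventually_c_nonzero
  show "\<forall>\<^sub>F i in F. dist (ln (mahler R i) / n i) (max 0 (ln R)) < \<eta>"
  proof eventually_elim
    case (elim i)
    then obtain k k' where k: "real k' \<le> \<epsilon> * n i" "k' \<le> d i" "d i choose k = d i choose k'"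
      "exp (- \<epsilon> * n i) \<le> norm (coeff (P i) k)" "n i * max 0 (ln R) - \<epsilon> * n i * \<bar>ln R\<bar> \<le> k * ln R"
      by blast
    have N: "\<eta> * n i > 0" using elim \<open>\<eta> > 0\<close> by simp
    have pos: "mahler R i > 0" using elim R by (intro mahler_pos) auto
    have "mahler R i \<le> exp (ln (n i + 1) + \<epsilon> * n i + n i * max 0 (ln R))"
      unfolding mahler_def using elim R
      by (intro prod_max_norm_roots_le) (auto simp: poly_P)
    then have "ln (mahler R i) \<le> ln (n i + 1) + \<epsilon> * n i + n i * max 0 (ln R)"
      using pos by (metis ln_exp ln_le_cancel_iff exp_gt_zero)
    moreover have "ln (1 + real (n i)) < \<eta> / 4 * n i"
      using elim by (simp add: divide_less_eq add.commute)
    moreover have "\<epsilon> * n i \<le> \<eta> / 4 * n i" using \<epsilon> by (intro mult_right_mono) auto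
    ultimately have up: "ln (mahler R i) < \<eta> * n i + n i * max 0 (ln R)" 
      using N by simp
    have "R ^ k * norm (coeff (P i) k) \<le> real (d i choose k) * mahler R i"
      using mult_left_mono[OF norm_coeff_prod_linear_le[OF R, of k "z i" "d i"], of "norm (c i)"]
      by (simp add: P_def norm_mult mahler_def mult_ac)
    then have "R ^ k * exp (- \<epsilon> * n i) \<le> real (d i choose k') * mahler R i"
      unfolding k(3)[symmetric]
      using mult_left_mono[OF k(4) zero_le_power[OF less_imp_le[OF R]], of k] by linarith
    then have "ln (R ^ k * exp (- \<epsilon> * n i)) \<le> ln (real (d i choose k') * mahler R i)"
      using R pos k(2) by (subst ln_le_cancel_iff) auto
    then have "k * ln R - \<epsilon> * n i \<le> ln (real (d i choose k')) + ln (mahler R i)"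
      using R pos k(2) by (simp add: ln_mult_pos ln_realpow)
    moreover have "ln (real (d i choose k')) \<le> x * d i + k' * ln (1 / x)"
      using x k(2) by (intro ln_binomial_le) auto
    moreover have "x * d i \<le> \<eta> / 4 * n i" using x deg_le[of i] by (intro mult_mono) auto
    moreover have "k' * ln (1 / x) \<le> \<epsilon> * n i * ln (1 / x)" using k(1) lx by (intro mult_right_mono) auto
    moreover have "\<epsilon> * n i * \<bar>ln R\<bar> + \<epsilon> * n i + \<epsilon> * n i * ln (1 / x) = \<epsilon> * L * n i"
      by (simp only: L_def distrib_left distrib_right mult_1_right mult_ac)
    ultimately have "n i * max 0 (ln R) - \<eta> / 2 * n i \<le> ln (mahler R i)"
      using k(5) unfolding \<epsilon>(2) by linarith
    then have "max 0 (ln R) - \<eta> / 2 \<le> ln (mahler R i) / n i"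
      using elim by (simp add: le_divide_eq algebra_simps)
    moreover have "ln (mahler R i) / n i < \<eta> + max 0 (ln R)"
      using up elim by (simp add: divide_less_eq algebra_simps)
    ultimately show ?case using \<open>\<eta> > 0\<close> unfolding dist_real_def by linarith
  qed
qed

lemma degree_tendsto: "((\<lambda>i. real (d i) / n i) \<longlongrightarrow> 1) F"
proof (rule tendstoI)
  fix \<eta> :: real assume "\<eta> > 0"
  then have "\<eta> / 2 > 0" by simp
  from coeff_high[OF this] eventually_n_pos
  show "\<forall>\<^sub>F i in F. dist (real (d i) / n i) 1 < \<eta>"
  proof eventually_elim
    case (elim i)
    then obtain k where k: "(1 - \<eta> / 2) * n i \<le> real k" "exp (- (\<eta> / 2) * n i) \<le> norm (coeff (P i) k)" by auto
    then have "(1 - \<eta> / 2) * n i \<le> d i" using coeff_P_nonzeroD[OF k(2)] by linarith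
    then have "1 - \<eta> / 2 \<le> real (d i) / n i" using elim by (simp add: field_simps)
    moreover have "real (d i) / n i \<le> 1" using deg_le[of i] elim by simp
    ultimately show ?case using \<open>\<eta> > 0\<close> by (simp add: dist_real_def abs_less_iff)
  qed
qed

end

section \<open>Concentration of the root moduli near the unit circle\<close>

context root_asymptotics
begin

text \<open>
  For \<open>x \<noteq> 0\<close> this is \<open>min \<bar>ln (norm x)\<bar> (ln 2)\<close>, written so that its sum over the roots is a combination of
  logarithms of \<^term>\<open>mahler\<close> at the radii \<open>1/2\<close>, \<open>1\<close> and \<open>2\<close>.
\<close>

definition radial :: "complex \<Rightarrow> real" where
  "radial x = ln 2 + 2 * ln (max 1 (norm x)) - ln (max (1/2) (norm x)) - ln (max 2 (norm x))"

lemma radial_nonneg: "radial x \<ge> 0"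
proof -
  consider "norm x \<le> 1/2" | "1/2 < norm x" "norm x \<le> 1" | "1 < norm x" "norm x \<le> 2" | "norm x > 2"
    by linarith
  moreover have "norm x \<le> 1 \<Longrightarrow> ln (norm x) \<le> 0" by (cases "x = 0") auto
  ultimately show ?thesis by cases (auto simp: radial_def max_def ln_div)
qed

text \<open>Where the norm is at most \<open>1/2\<close> or above \<open>2\<close>,
  \<open>radial\<close> equals \<open>ln 2\<close>, so \<open>\<delta> \<le> ln 2\<close> excludes
  these cases. In between it equals \<open>\<bar>ln (norm x)\<bar>\<close>, which the third premise
  compares with \<open>ln (1 + e)\<close>.\<close>

lemma norm_near_1_of_radial_less:
  assumes "radial x < \<delta>" "\<delta> \<le> ln 2" "\<delta> \<le> ln (1 + e)" "e > 0"
  shows "\<bar>norm x - 1\<bar> < e"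
proof -
  consider "norm x \<le> 1/2" | "1/2 < norm x" "norm x \<le> 1" | "1 < norm x" "norm x \<le> 2" | "norm x > 2"
    by linarith
  then show ?thesis
  proof cases
    case 1
    then have "radial x = ln 2" by (simp add: radial_def max_absorb1 ln_div)
    then show ?thesis using assms by simp
  next
    case 2
    then have "- ln (norm x) < ln (1 + e)" using assms by (auto simp: radial_def max_def ln_div split: if_splits)
    moreover have x0: "x \<noteq> 0" using 2 by auto
    ultimately have "ln (1 / norm x) < ln (1 + e)" by (simp add: ln_div)
    then have "1 / norm x < 1 + e" using 2 assms by (subst (asm) ln_less_cancel_iff) auto
    then have "1 < norm x + e * norm x" using x0 by (simp add: divide_less_eq algebra_simps)
    moreover have "e * norm x \<le> e" using 2 assms by simp
    ultimately show ?thesis using 2 by linarith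
  next
    case 3
    then have "ln (norm x) < ln (1 + e)" using assms by (auto simp: radial_def max_def ln_div split: if_splits)
    then show ?thesis using 3 assms by (subst (asm) ln_less_cancel_iff) auto
  qed (use assms in \<open>auto simp: radial_def max_def ln_div\<close>)
qed

text \<open>The terms \<open>ln (norm (c i))\<close> cancel because the weights \<open>2\<close>,
  \<open>-1\<close>, \<open>-1\<close> of the three radii add up to zero. In the limit the
  \<open>ln 2\<close> of the degree cancels the \<open>ln 2\<close> of radius \<open>2\<close>, and
  the other two radii contribute nothing.\<close>

lemma radial_mean_tendsto: "((\<lambda>i. (\<Sum>j<d i. radial (z i j)) / n i) \<longlongrightarrow> 0) F"
proof -
  have "((\<lambda>i. ln 2 * (d i / n i) + 2 * (ln (mahler 1 i) / n i)
           - ln (mahler (1/2) i) / n i - ln (mahler 2 i) / n i) \<longlongrightarrow>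
         ln 2 * 1 + 2 * max 0 (ln 1) - max 0 (ln (1/2)) - max 0 (ln 2)) F"
    by (intro tendsto_intros degree_tendsto ln_mahler_tendsto) auto
  also have "ln 2 * 1 + 2 * max 0 (ln 1) - max 0 (ln (1/2)) - max 0 (ln 2) = (0::real)"
    by (simp add: ln_div)
  finally show ?thesis
  proof (rule Lim_transform_eventually)
    show "\<forall>\<^sub>F i in F. ln 2 * (d i / n i) + 2 * (ln (mahler 1 i) / n i)
           - ln (mahler (1/2) i) / n i - ln (mahler 2 i) / n i = (\<Sum>j<d i. radial (z i j)) / n i"
      using eventually_c_nonzero
    proof eventually_elim
      case (elim i)
      then show ?case
        by (simp add: ln_mahler radial_def sum_subtractf sum.distrib diff_divide_distrib add_divide_distrib 
            flip: sum_distrib_left)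
    qed
  qed
qed

text \<open>A Markov argument: a root near the circle contributes at most \<open>\<eta> / 2\<close>,
  and any other root has \<open>radial\<close> at least \<open>\<delta>\<close>, so that
  \<open>C\<close> is at most \<open>C / \<delta>\<close> times \<open>radial\<close>, whose mean
  tends to \<open>0\<close>.\<close>

lemma root_mean_tendsto_0:
  fixes f :: "complex \<Rightarrow> 'b::real_normed_vector"
  assumes bounded: "\<And>x. norm (f x) \<le> C"
    and near: "\<And>\<eta>. \<eta> > 0 \<Longrightarrow> \<exists>\<delta>>0. \<forall>x. \<bar>norm x - 1\<bar> < \<delta> \<longrightarrow> norm (f x) \<le> \<eta>"
  shows "((\<lambda>i. (\<Sum>j<d i. f (z i j)) /\<^sub>R n i) \<longlongrightarrow> 0) F"
proof (rule tendstoI)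
  fix \<eta> :: real assume "\<eta> > 0"
  then obtain e where e: "e > 0" "\<And>x. \<bar>norm x - 1\<bar> < e \<Longrightarrow> norm (f x) \<le> \<eta> / 2"
    using near[of "\<eta> / 2"] by auto
  define \<delta> where "\<delta> = min (ln 2) (ln (1 + e))"
  have \<delta>: "\<delta> > 0" using e by (simp add: \<delta>_def)
  have C: "C \<ge> 0" using bounded[of 0] norm_ge_zero order_trans by blast
  have f_le: "norm (f x) \<le> \<eta> / 2 + C / \<delta> * radial x" for x
  proof (cases "radial x < \<delta>")
    case True
    then have "norm (f x) \<le> \<eta> / 2"
      using e True by (intro e(2) norm_near_1_of_radial_less[of x \<delta> e]) (auto simp: \<delta>_def)
    moreover have "C / \<delta> * radial x \<ge> 0" using C \<delta> radial_nonneg by simp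
    ultimately show ?thesis by linarith
  next
    case False
    then have "C * 1 \<le> C * (radial x / \<delta>)" using \<delta> C by (intro mult_left_mono) auto
    then show ?thesis using bounded[of x] \<open>\<eta> > 0\<close> by simp
  qed
  have "((\<lambda>i. \<eta> / 2 + C / \<delta> * ((\<Sum>j<d i. radial (z i j)) / n i)) \<longlongrightarrow> \<eta> / 2 + C / \<delta> * 0) F"
    by (intro tendsto_intros radial_mean_tendsto)
  then have "\<forall>\<^sub>F i in F. \<eta> / 2 + C / \<delta> * ((\<Sum>j<d i. radial (z i j)) / n i) < \<eta>"
    by (rule order_tendstoD(2)) (use \<open>\<eta> > 0\<close> in simp)
  with eventually_n_pos show "\<forall>\<^sub>F i in F. dist ((\<Sum>j<d i. f (z i j)) /\<^sub>R n i) 0 < \<eta>"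
  proof eventually_elim
    case (elim i)
    have "norm (\<Sum>j<d i. f (z i j)) \<le> (\<Sum>j<d i. \<eta> / 2 + C / \<delta> * radial (z i j))"
      by (intro sum_norm_le f_le)
    also have "\<dots> = \<eta> / 2 * d i + C / \<delta> * (\<Sum>j<d i. radial (z i j))"
      by (simp add: sum.distrib sum_distrib_left)
    also have "\<dots> \<le> \<eta> / 2 * n i + C / \<delta> * (\<Sum>j<d i. radial (z i j))"
      using deg_le[of i] \<open>\<eta> > 0\<close> by (intro add_right_mono mult_left_mono) auto
    also have "\<dots> = (\<eta> / 2 + C / \<delta> * ((\<Sum>j<d i. radial (z i j)) / n i)) * n i"
      using elim by (simp add: field_simps)
    also have "\<dots> < \<eta> * n i" using elim by (intro mult_strict_right_mono) auto
    finally show ?case using elim by (simp add: field_simps)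
  qed
qed

section \<open>Power sums of the root directions\<close>

text \<open>The value \<open>1\<close> at \<open>0\<close>, where \<^const>\<open>sgn\<close> vanishes, keeps the projection on the circle.\<close>

definition proj :: "complex \<Rightarrow> complex" where
  "proj x = (if x = 0 then 1 else sgn x)"

lemma norm_proj [simp]: "norm (proj x) = 1"
  by (simp add: proj_def norm_sgn)

lemma norm_diff_proj: "norm (x - proj x) = \<bar>norm x - 1\<bar>"
proof (cases "x = 0")
  case False
  then have "x - proj x = (1 - 1 / norm x) *\<^sub>R x"
    by (simp add: proj_def sgn_div_norm scaleR_left_diff_distrib divide_inverse)
  then have "norm (x - proj x) = \<bar>1 - 1 / norm x\<bar> * norm x" by simp
  also have "\<dots> = \<bar>(1 - 1 / norm x) * norm x\<bar>" by (simp add: abs_mult)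
  also have "(1 - 1 / norm x) * norm x = norm x - 1" using False by (simp add: field_simps)
  finally show ?thesis .
qed (simp add: proj_def)

text \<open>The \<open>\<zeta>\<close> for which \<open>1 - \<zeta> * u\<close> has, on the unit
  circle, the modulus of \<open>u - x\<close> up to the constant \<open>max 1 (norm x)\<close>. A
  nonzero value points in the direction of \<open>cnj x\<close> in both cases, hence the conjugates
  in the power sums below.\<close>

definition reflect :: "complex \<Rightarrow> complex" where
  "reflect x = (if norm x \<le> 1 then cnj x else 1 / x)"

lemma norm_reflect_le: "norm (reflect x) \<le> 1"
  by (auto simp: reflect_def norm_divide divide_le_eq_1)

lemma norm_diff_reflect:
  assumes "norm u = 1"
  shows "norm (u - x) = max 1 (norm x) * norm (1 - reflect x * u)"
proof (cases "norm x \<le> 1")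
  case True
  have uu: "u * cnj u = 1" using assms by (simp add: complex_norm_square[symmetric])
  have "norm (1 - reflect x * u) = norm (cnj (1 - reflect x * u))" by (simp only: complex_mod_cnj)
  also have "cnj (1 - reflect x * u) = cnj u * (u - x)" using uu True by (simp add: reflect_def algebra_simps)
  also have "norm \<dots> = norm (u - x)" using assms by (simp add: norm_mult)
  finally show ?thesis using True by (simp add: max_def)
next
  case False
  then have "u - x = - x * (1 - reflect x * u)" by (auto simp: reflect_def field_simps)
  also have "norm \<dots> = max 1 (norm x) * norm (1 - reflect x * u)"
    using False by (subst norm_mult) simp
  finally show ?thesis .
qed

text \<open>For \<open>x \<noteq> 0\<close> both numbers point in the direction of
  \<open>cnj x\<close>, so only the moduli differ: by \<open>1 - norm x\<close> inside the disc and
  by \<open>1 - 1 / norm x \<le> norm x - 1\<close> outside.\<close>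

lemma norm_proj_diff_reflect: "norm (cnj (proj x) - reflect x) \<le> \<bar>norm x - 1\<bar>"
proof (cases "norm x \<le> 1")
  case True
  then have "norm (cnj (proj x) - reflect x) = norm (cnj (x - proj x))"
    by (simp add: reflect_def norm_minus_commute)
  then show ?thesis by (simp add: norm_diff_proj del: complex_cnj_diff)
next
  case False
  then have "x \<noteq> 0" by auto
  then have "1 / x = cnj x / (norm x)\<^sup>2" by (simp add: complex_norm_square divide_simps del: of_real_power)
  then have "cnj (proj x) - reflect x = cnj (proj x) * of_real (1 - 1 / norm x)"
    using False \<open>x \<noteq> 0\<close>
    by (simp add: proj_def reflect_def sgn_div_norm scaleR_conv_of_real divide_simps power2_eq_square algebra_simps)
  then have "norm (cnj (proj x) - reflect x) = \<bar>1 - 1 / norm x\<bar>"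
    by (simp add: norm_mult del: of_real_diff)
  also have "\<dots> = 1 - 1 / norm x" using False by (subst abs_of_nonneg) (auto simp: divide_le_eq)
  also have "\<dots> \<le> norm x - 1"
  proof -
    have "0 \<le> (norm x - 1)\<^sup>2 / norm x" by simp
    also have "\<dots> = norm x - 1 - (1 - 1 / norm x)" using \<open>x \<noteq> 0\<close> by (simp add: field_simps power2_eq_square)
    finally show ?thesis by simp
  qed
  finally show ?thesis using False by simp
qed

text \<open>On the unit circle, the polynomial divided by \<open>mahler 1 i\<close> has the modulus
  of the product of the factors \<open>1 - reflect (z i j) * u\<close>. Numerator and denominator
  are both controlled on the exponential scale, so the bound on power sums applies.\<close>

lemma reflect_power_sum_tendsto_0:
  assumes "m > 0"
  shows "((\<lambda>i. (\<Sum>j<d i. reflect (z i j) ^ m) / n i) \<longlongrightarrow> 0) F"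
proof (rule tendstoI)
  fix \<eta> :: real assume "\<eta> > 0"
  \<comment> \<open>With this choice the final bound \<open>2 * m * A i / n i\<close> tends to
    \<open>2 * m * \<epsilon> = \<eta> / 2\<close>.\<close>
  define \<epsilon> where "\<epsilon> = \<eta> / (4 * m)"
  have \<epsilon>: "\<epsilon> > 0" using \<open>\<eta> > 0\<close> assms by (simp add: \<epsilon>_def)
  \<comment> \<open>The summand \<open>1\<close> makes \<open>A i\<close> positive; the absolute
    value bounds the effect of dividing by \<open>mahler 1 i\<close> whatever the sign of its
    logarithm.\<close>
  define A where "A i = 1 + ln (n i + 1) + \<epsilon> * n i + \<bar>ln (mahler 1 i)\<bar>" for i
  have l1: "((\<lambda>i. 1 / real (n i)) \<longlongrightarrow> 0) F"
    by (rule filterlim_compose[OF lim_1_over_n n_at_top])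
  have "((\<lambda>i. 2 * m * (1 / n i + ln (real (n i) + 1) / n i + \<epsilon> + \<bar>ln (mahler 1 i) / n i\<bar>)) \<longlongrightarrow>
          2 * m * (0 + 0 + \<epsilon> + \<bar>max 0 (ln 1)\<bar>)) F"
    by (intro tendsto_intros l1 ln_mahler_tendsto filterlim_compose[OF ln_Suc_over_tendsto_0 n_at_top]) auto
  then have "\<forall>\<^sub>F i in F. 2 * m * (1 / n i + ln (real (n i) + 1) / n i + \<epsilon> + \<bar>ln (mahler 1 i) / n i\<bar>) < \<eta>"
    by (rule order_tendstoD(2)) (use \<open>\<eta> > 0\<close> assms in \<open>simp add: \<epsilon>_def\<close>)
  with eventually_n_pos eventually_c_nonzero eventually_poly_le[OF \<epsilon> zero_less_one]
  show "\<forall>\<^sub>F i in F. dist ((\<Sum>j<d i. reflect (z i j) ^ m) / n i) 0 < \<eta>"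
  proof eventually_elim
    case (elim i)
    have pos: "mahler 1 i > 0" using elim by (intro mahler_pos) auto
    have A: "A i > 0" using \<epsilon> by (auto simp: A_def intro!: add_pos_nonneg)
    have "norm (\<Sum>j<d i. reflect (z i j) ^ m) \<le> 2 * real m * A i"
    proof (rule norm_power_sum_le_of_norm_prod_le)
      fix u :: complex assume u: "norm u = 1"
      have "norm (poly (P i) u) = mahler 1 i * norm (\<Prod>j<d i. 1 - reflect (z i j) * u)"
        by (simp add: poly_P norm_mult norm_diff_reflect[OF u] mahler_def prod.distrib mult_ac flip: prod_norm)
      moreover have "norm (poly (P i) u) \<le> exp (ln (n i + 1) + \<epsilon> * n i)"
        using elim(3) u by auto
      ultimately have "norm (\<Prod>j<d i. 1 - reflect (z i j) * u) \<le> exp (ln (n i + 1) + \<epsilon> * n i) / mahler 1 i"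
        using pos by (simp only: pos_le_divide_eq mult.commute)
      also have "\<dots> = exp (ln (n i + 1) + \<epsilon> * n i - ln (mahler 1 i))"
        using pos by (simp add: exp_diff)
      also have "\<dots> \<le> exp (A i)" by (simp add: A_def)
      finally show "norm (\<Prod>j<d i. 1 - reflect (z i j) * u) \<le> exp (A i)" .
    qed (use assms A norm_reflect_le in auto)
    then have "norm ((\<Sum>j<d i. reflect (z i j) ^ m) / n i) \<le> 2 * m * A i / n i"
      using elim by (simp add: norm_divide divide_right_mono)
    also have "\<dots> = 2 * m * (1 / n i + ln (real (n i) + 1) / n i + \<epsilon> + \<bar>ln (mahler 1 i) / n i\<bar>)"
      using elim by (simp add: A_def field_simps)
    also have "\<dots> < \<eta>" by (rule elim)
    finally show ?case by simp
  qed
qed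

text \<open>In the closed unit disc the \<open>m\<close>-th power is Lipschitz with constant
  \<open>m\<close>, so replacing \<open>reflect\<close> by \<open>cnj (proj x)\<close> costs little
  near the circle and a bounded amount elsewhere.\<close>

lemma proj_power_sum_tendsto_0:
  assumes "m > 0"
  shows "((\<lambda>i. (\<Sum>j<d i. cnj (proj (z i j)) ^ m) / n i) \<longlongrightarrow> 0) F"
proof -
  have "((\<lambda>i. (\<Sum>j<d i. cnj (proj (z i j)) ^ m - reflect (z i j) ^ m) /\<^sub>R n i) \<longlongrightarrow> 0) F"
  proof (rule root_mean_tendsto_0)
    fix x :: complex
    have "norm (cnj (proj x) ^ m - reflect x ^ m) \<le> norm (cnj (proj x) ^ m) + norm (reflect x ^ m)"
      by (rule norm_triangle_ineq4)
    also have "\<dots> \<le> 1 + 1" 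
      by (intro add_mono) (auto simp: norm_power norm_reflect_le power_le_one)
    finally show "norm (cnj (proj x) ^ m - reflect x ^ m) \<le> 2" by simp
  next
    fix \<eta> :: real assume "\<eta> > 0"
    show "\<exists>\<delta>>0. \<forall>x. \<bar>norm x - 1\<bar> < \<delta> \<longrightarrow> norm (cnj (proj x) ^ m - reflect x ^ m) \<le> \<eta>"
    proof (intro exI conjI allI impI)
      fix x :: complex assume x: "\<bar>norm x - 1\<bar> < \<eta> / m"
      have "norm (cnj (proj x) ^ m - reflect x ^ m) \<le> m * norm (cnj (proj x) - reflect x)"
        by (intro norm_power_diff) (auto simp: norm_reflect_le)
      also have "\<dots> \<le> m * (\<eta> / m)"
        using norm_proj_diff_reflect[of x] x by (intro mult_left_mono) auto
      finally show "norm (cnj (proj x) ^ m - reflect x ^ m) \<le> \<eta>" using assms by simp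
    qed (use assms \<open>\<eta> > 0\<close> in simp)
  qed
  from tendsto_add[OF this reflect_power_sum_tendsto_0[OF assms]]
  show ?thesis
    by (simp add: sum_subtractf scaleR_conv_of_real divide_inverse algebra_simps)
qed

end

section \<open>Laurent polynomials on the unit circle\<close>

inductive laurent :: "(complex \<Rightarrow> complex) \<Rightarrow> bool" where
  monom: "laurent (\<lambda>u. a * u powi k)"
| add: "laurent f \<Longrightarrow> laurent g \<Longrightarrow> laurent (\<lambda>u. f u + g u)"

text \<open>The rule \<open>u powi (l + k) = u powi l * u powi k\<close> can fail at
  \<open>0\<close>, so products of Laurent polynomials are represented only on the unit
  circle.\<close>

lemma laurent_mult_monom:
  assumes "laurent f"
  shows "\<exists>h. laurent h \<and> (\<forall>u. norm u = 1 \<longrightarrow> h u = f u * (a * u powi k))"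
  using assms
proof induction
  case (monom b l)
  show ?case
  proof (intro exI conjI allI impI)
    show "laurent (\<lambda>u. (b * a) * u powi (l + k))" by (rule laurent.monom)
    fix u :: complex assume "norm u = 1"
    then have "u \<noteq> 0" by auto
    then show "(b * a) * u powi (l + k) = b * u powi l * (a * u powi k)"
      by (simp add: power_int_add)
  qed
next
  case (add f g)
  then obtain h1 h2 where "laurent h1" "\<forall>u. norm u = 1 \<longrightarrow> h1 u = f u * (a * u powi k)"
    "laurent h2" "\<forall>u. norm u = 1 \<longrightarrow> h2 u = g u * (a * u powi k)" by blast
  then show ?case
    by (intro exI[of _ "\<lambda>u. h1 u + h2 u"]) (auto intro: laurent.add simp: distrib_right)
qed

lemma laurent_mult:
  assumes "laurent g" "laurent f"
  shows "\<exists>h. laurent h \<and> (\<forall>u. norm u = 1 \<longrightarrow> h u = f u * g u)"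
  using assms
proof induction
  case (monom b l)
  then show ?case using laurent_mult_monom by blast
next
  case (add g1 g2)
  then obtain h1 h2 where "laurent h1" "\<forall>u. norm u = 1 \<longrightarrow> h1 u = f u * g1 u"
    "laurent h2" "\<forall>u. norm u = 1 \<longrightarrow> h2 u = f u * g2 u" by blast
  then show ?case
    by (intro exI[of _ "\<lambda>u. h1 u + h2 u"]) (auto intro: laurent.add simp: distrib_left)
qed

text \<open>On the circle \<open>cnj u\<close> is \<open>u powi (-1)\<close>, so the real and
  imaginary parts of \<open>u\<close>, and with them all real polynomials in these, become Laurent
  polynomials.\<close>

lemma real_polynomial_function_laurent:
  assumes "real_polynomial_function p"
  shows "\<exists>h. laurent h \<and> (\<forall>u. norm u = 1 \<longrightarrow> of_real (p u) = h u)"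
  using assms
proof induction
  case (linear f)
  \<comment> \<open>Here \<open>b = cnj a\<close>, chosen so that \<open>a * u + b * cnj u\<close>
    is \<open>Re u * f 1 + Im u * f \<i>\<close>.\<close>
  define a b where "a = Complex (f 1 / 2) (- f \<i> / 2)" and "b = Complex (f 1 / 2) (f \<i> / 2)"
  show ?case
  proof (intro exI conjI allI impI)
    show "laurent (\<lambda>u. a * u powi 1 + b * u powi (-1))" by (intro laurent.intros)
    fix u :: complex assume u: "norm u = 1"
    have "inverse u = cnj u" using u by (metis complex_mod_sqrt_Re_mult_cnj inverse_unique mult_1 norm_one complex_norm_square of_real_1 one_power2)
    then have inv: "u powi (-1) = cnj u" by (simp add: power_int_minus)
    have "u = Re u *\<^sub>R 1 + Im u *\<^sub>R \<i>" by (simp add: complex_eq_iff)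
    then have "f u = f (Re u *\<^sub>R 1 + Im u *\<^sub>R \<i>)" by simp
    also have "\<dots> = Re u * f 1 + Im u * f \<i>"
      using linear by (simp add: bounded_linear.linear linear_add linear_cmul)
    finally show "of_real (f u) = a * u powi 1 + b * u powi (-1)"
      unfolding inv by (simp add: a_def b_def complex_eq_iff)
  qed
next
  case (const c)
  have "laurent (\<lambda>u. of_real c * u powi 0)" by (rule laurent.monom)
  then show ?case by (intro exI[of _ "\<lambda>u. of_real c"]) simp
next
  case (add f g)
  then obtain h1 h2 where "laurent h1" "\<forall>u. norm u = 1 \<longrightarrow> of_real (f u) = h1 u"
    "laurent h2" "\<forall>u. norm u = 1 \<longrightarrow> of_real (g u) = h2 u" by blast
  then show ?case
    by (intro exI[of _ "\<lambda>u. h1 u + h2 u"]) (auto intro: laurent.add)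
next
  case (mult f g)
  then obtain h1 h2 where "laurent h1" "\<forall>u. norm u = 1 \<longrightarrow> of_real (f u) = h1 u"
    "laurent h2" "\<forall>u. norm u = 1 \<longrightarrow> of_real (g u) = h2 u" by blast
  with laurent_mult[of h2 h1] show ?case by auto
qed

lemma cis_powi: "cis t powi k = cis (of_int k * t)"
  by (simp add: power_int_def Complex.DeMoivre)

lemma circle_mean_monom:
  fixes a :: complex
  shows "integral {0..2*pi} (\<lambda>t. a * cis t powi k) = (if k = 0 then 2 * pi * a else 0)"
proof (cases "k = 0")
  case True
  then show ?thesis by (simp add: scaleR_conv_of_real)
next
  case False
  have "((\<lambda>t. a * cis t powi k) has_integral
      (a * cis (of_int k * (2 * pi)) / (\<i> * of_int k) - a * cis (of_int k * 0) / (\<i> * of_int k))) {0..2*pi}"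
  proof (rule fundamental_theorem_of_calculus)
    fix t :: real
    show "((\<lambda>t. a * cis (of_int k * t) / (\<i> * of_int k)) has_vector_derivative a * cis t powi k) (at t within {0..2*pi})"
      unfolding cis_powi unfolding cis_conv_exp of_real_mult of_real_of_int_eq using False
      by (intro has_vector_derivative_real_field) (auto intro!: derivative_eq_intros simp: field_simps)
  qed simp
  moreover have "cis (of_int k * (2 * pi)) = 1"
    by (metis cis_multiple_2pi mult.commute Ints_of_int)
  ultimately have "((\<lambda>t. a * cis t powi k) has_integral 0) {0..2*pi}" by simp
  from integral_unique[OF this] False show ?thesis by (simp only: if_False)
qed

lemma laurent_continuous:
  assumes "laurent f" shows "continuous_on A (\<lambda>t. f (cis t))"
  using assms
proof induction
  case (monom a k)
  show ?case unfolding cis_powi by (intro continuous_intros)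
qed (intro continuous_intros)

section \<open>Equidistribution of the roots on the circle\<close>

context root_asymptotics
begin

text \<open>Weyl's criterion for one frequency at a time: frequency \<open>0\<close> is the degree
  asymptotics, negative frequencies are power sums of conjugates, and positive ones follow by
  conjugation.\<close>

lemma laurent_mean_tendsto:
  assumes "laurent f"
  shows "((\<lambda>i. (\<Sum>j<d i. f (proj (z i j))) / n i) \<longlongrightarrow> integral {0..2*pi} (\<lambda>t. f (cis t)) / (2 * pi)) F"
  using assms
proof induction
  case (monom a k)
  have "((\<lambda>i. (\<Sum>j<d i. proj (z i j) powi k) / n i) \<longlongrightarrow> (if k = 0 then 1 else 0)) F"
  proof (cases k "0 :: int" rule: linorder_cases)
    case less
    have inv: "inverse (proj x) = cnj (proj x)" for x
      using norm_proj[of x] by (metis inverse_unique complex_norm_square of_real_1 one_power2)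
    have "nat (- k) > 0" using less by simp
    from proj_power_sum_tendsto_0[OF this] show ?thesis
      using less by (simp add: power_int_def inv)
  next
    case equal
    have "((\<lambda>i. complex_of_real (d i / n i)) \<longlongrightarrow> of_real 1) F"
      by (intro tendsto_of_real degree_tendsto)
    then show ?thesis using equal by simp
  next
    case greater
    then have "nat k > 0" by simp
    from tendsto_cnj[OF proj_power_sum_tendsto_0[OF this]] show ?thesis
      using greater by (simp add: power_int_def)
  qed
  from tendsto_mult[OF tendsto_const[of a] this] show ?case
    unfolding circle_mean_monom by (cases "k = 0") (simp_all add: sum_distrib_left mult.commute)
next
  case (add f g)
  have "integral {0..2*pi} (\<lambda>t. f (cis t) + g (cis t)) =
      integral {0..2*pi} (\<lambda>t. f (cis t)) + integral {0..2*pi} (\<lambda>t. g (cis t))"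
    using add by (intro integral_add integrable_continuous_interval laurent_continuous)
  with tendsto_add[OF add.IH] show ?case
    by (simp add: sum.distrib add_divide_distrib)
qed

text \<open>Stone-Weierstrass gives a polynomial \<open>p\<close> within \<open>e\<close> of
  \<open>g\<close> on the circle. Passing from \<open>g\<close> to \<open>p\<close> costs
  \<open>e\<close> in the root mean, as there are at most \<open>n i\<close> roots, and
  \<open>e\<close> in the circle mean; the third \<open>e\<close> is the convergence for
  \<open>p\<close>.\<close>

lemma circle_mean_tendsto:
  fixes g :: "complex \<Rightarrow> real"
  assumes g: "continuous_on (sphere 0 1) g"
  shows "((\<lambda>i. (\<Sum>j<d i. g (proj (z i j))) / n i) \<longlongrightarrow> integral {0..2*pi} (\<lambda>t. g (cis t)) / (2 * pi)) F"
proof (rule tendstoI)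
  fix \<eta> :: real assume "\<eta> > 0"
  define e where "e = \<eta> / 3"
  have e: "e > 0" using \<open>\<eta> > 0\<close> by (simp add: e_def)
  obtain p where p: "real_polynomial_function p" "\<And>x. x \<in> sphere 0 1 \<Longrightarrow> \<bar>g x - p x\<bar> < e"
    using Stone_Weierstrass_real_polynomial_function[OF compact_sphere g e] by metis
  from real_polynomial_function_laurent[OF p(1)] obtain h
    where h: "laurent h" "\<And>u. norm u = 1 \<Longrightarrow> of_real (p u) = h u" by auto
  let ?I = "\<lambda>f. integral {0..2*pi} (\<lambda>t. f (cis t) :: real)"
  have cis: "continuous_on A cis" for A
    by (intro continuous_intros)
  have cp: "continuous_on A (\<lambda>t. p (cis t))" for A
    using p(1) by (intro continuous_on_compose2[OF continuous_on_polymonial_function[of p UNIV]] cis)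
      (auto simp: real_polynomial_function_eq)
  have cg: "continuous_on A (\<lambda>t. g (cis t))" for A
    by (intro continuous_on_compose2[OF g cis]) auto
  have "integral {0..2*pi} (complex_of_real \<circ> (\<lambda>t. p (cis t))) = complex_of_real (?I p)"
    by (rule integral_linear[OF integrable_continuous_interval[OF cp] bounded_linear_of_real])
  then have I: "integral {0..2*pi} (\<lambda>t. h (cis t)) / (2 * pi) = of_real (?I p / (2 * pi))"
    by (simp add: h(2)[symmetric] o_def)
  have S: "(\<Sum>j<d i. h (proj (z i j))) / n i = complex_of_real ((\<Sum>j<d i. p (proj (z i j))) / n i)" for i
    by (simp add: h(2)[symmetric])
  have "((\<lambda>i. complex_of_real ((\<Sum>j<d i. p (proj (z i j))) / n i)) \<longlongrightarrow> of_real (?I p / (2 * pi))) F"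
    using laurent_mean_tendsto[OF h(1)] unfolding I S .
  then have "((\<lambda>i. (\<Sum>j<d i. p (proj (z i j))) / n i) \<longlongrightarrow> ?I p / (2 * pi)) F"
    by (simp only: tendsto_of_real_iff)
  from tendstoD[OF this e] eventually_n_pos
  show "\<forall>\<^sub>F i in F. dist ((\<Sum>j<d i. g (proj (z i j))) / n i) (?I g / (2 * pi)) < \<eta>"
  proof eventually_elim
    case (elim i)
    have "\<bar>(\<Sum>j<d i. g (proj (z i j))) - (\<Sum>j<d i. p (proj (z i j)))\<bar> \<le> (\<Sum>j<d i. e)"
      unfolding sum_subtractf[symmetric] using p(2) less_imp_le
      by (intro order_trans[OF sum_abs] sum_mono) (auto simp: less_imp_le)
    also have "\<dots> \<le> e * n i" using deg_le[of i] e by simp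
    finally have "\<bar>(\<Sum>j<d i. g (proj (z i j))) / n i - (\<Sum>j<d i. p (proj (z i j))) / n i\<bar> \<le> e"
      using elim by (simp add: divide_le_eq flip: diff_divide_distrib)
    moreover have "\<bar>?I p / (2 * pi) - ?I g / (2 * pi)\<bar> \<le> e"
    proof -
      have "?I p - ?I g = integral {0..2*pi} (\<lambda>t. p (cis t) - g (cis t))"
        by (intro integral_diff[symmetric] integrable_continuous_interval cp cg)
      also have "\<bar>\<dots>\<bar> \<le> e * (2 * pi - 0)"
        using p(2) unfolding real_norm_def[symmetric]
        by (intro integral_bound continuous_on_diff cp cg) (auto simp: abs_minus_commute less_imp_le)
      finally show ?thesis by (simp add: divide_le_eq flip: diff_divide_distrib)
    qed
    ultimately show ?case using elim(1) unfolding dist_real_def e_def by linarith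
  qed
qed

text \<open>Split \<open>g\<close> into \<open>g (proj x)\<close>, which depends on the direction
  alone, and the remainder, which is bounded and small near the circle by uniform
  continuity.\<close>

theorem root_mean_tendsto:
  fixes g :: "complex \<Rightarrow> real"
  assumes g: "continuous_on UNIV g" and bounded: "\<And>x. \<bar>g x\<bar> \<le> C"
  shows "((\<lambda>i. (\<Sum>j<d i. g (z i j)) / n i) \<longlongrightarrow> integral {0..2*pi} (\<lambda>t. g (cis t)) / (2 * pi)) F"
proof -
  have "((\<lambda>i. (\<Sum>j<d i. g (z i j) - g (proj (z i j))) /\<^sub>R n i) \<longlongrightarrow> 0) F"
  proof (rule root_mean_tendsto_0)
    fix x show "norm (g x - g (proj x)) \<le> 2 * C"
      using bounded[of x] bounded[of "proj x"] by simp
  next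
    fix \<eta> :: real assume "\<eta> > 0"
    have "uniformly_continuous_on (cball 0 2) g"
      using g by (intro compact_uniformly_continuous continuous_on_subset[OF g]) auto
    then obtain \<delta> where \<delta>: "\<delta> > 0" "\<And>x y. x \<in> cball 0 2 \<Longrightarrow> y \<in> cball 0 2 \<Longrightarrow> dist x y < \<delta> \<Longrightarrow> dist (g x) (g y) < \<eta>"
      using \<open>\<eta> > 0\<close> unfolding uniformly_continuous_on_def by metis
    show "\<exists>\<delta>>0. \<forall>x. \<bar>norm x - 1\<bar> < \<delta> \<longrightarrow> norm (g x - g (proj x)) \<le> \<eta>"
    proof (intro exI conjI allI impI)
      \<comment> \<open>The bound \<open>1\<close> keeps \<open>x\<close> in
        \<open>cball 0 2\<close>, where \<open>g\<close> is uniformly continuous.\<close>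
      fix x :: complex assume x: "\<bar>norm x - 1\<bar> < min \<delta> 1"
      have "dist (g x) (g (proj x)) < \<eta>"
        using x by (intro \<delta>(2)) (auto simp: dist_norm norm_diff_proj)
      then show "norm (g x - g (proj x)) \<le> \<eta>" by (simp add: dist_norm)
    qed (use \<delta> in simp)
  qed
  moreover have "continuous_on (sphere 0 1) g" using g by (rule continuous_on_subset) simp
  ultimately have "((\<lambda>i. (\<Sum>j<d i. g (z i j) - g (proj (z i j))) /\<^sub>R n i + (\<Sum>j<d i. g (proj (z i j))) / n i)
      \<longlongrightarrow> 0 + integral {0..2*pi} (\<lambda>t. g (cis t)) / (2 * pi)) F"
    by (intro tendsto_add circle_mean_tendsto)
  moreover have "(\<Sum>j<d i. g (z i j) - g (proj (z i j))) /\<^sub>R n i + (\<Sum>j<d i. g (proj (z i j))) / n i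
      = (\<Sum>j<d i. g (z i j)) / n i" for i
    by (simp add: sum_subtractf right_diff_distrib divide_inverse mult.commute)
  ultimately show ?thesis by simp
qed

end

section \<open>Zero measures and the uniform measure on a circle\<close>

lemma zorder_poly:
  fixes p :: "complex poly"
  assumes "p \<noteq> 0"
  shows "zorder (poly p) a = int (order a p)"
proof -
  obtain q where q: "p = [:- a, 1:] ^ order a p * q" "\<not> [:- a, 1:] dvd q"
    using order_decomp[OF assms] by blast
  show ?thesis
  proof (rule zorder_eqI[of UNIV _ "poly q"])
    show "poly q a \<noteq> 0" using q(2) by (simp add: poly_eq_0_iff_dvd)
    show "poly p x = poly q x * (x - a) powi int (order a p)" for x
      by (subst q(1)) (simp add: poly_power)
  qed (auto intro!: holomorphic_intros)
qed

lemma sum_mset_eq_sum_count: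
  fixes f :: "'b \<Rightarrow> real"
  shows "(\<Sum>x\<in>#A. f x) = (\<Sum>x\<in>set_mset A. count A x * f x)"
proof (induction A)
  case (add a A)
  have "(\<Sum>x\<in>insert a (set_mset A). count (add_mset a A) x * f x) =
      (\<Sum>x\<in>insert a (set_mset A). count A x * f x + (if x = a then f x else 0))"
    by (intro sum.cong) (auto simp: algebra_simps)
  also have "\<dots> = (\<Sum>x\<in>insert a (set_mset A). count A x * f x) + f a"
    by (simp add: sum.distrib)
  also have "(\<Sum>x\<in>insert a (set_mset A). count A x * f x) = (\<Sum>x\<in>set_mset A. count A x * f x)"
    by (rule sum.mono_neutral_right) (auto simp: not_in_iff)
  finally show ?case using add by simp
qed simp

lemma sets_zero_measure [simp]: "sets (zero_measure G) = sets borel"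
  by (simp add: zero_measure_def)

lemma zero_measure_poly:
  fixes p :: "complex poly"
  assumes "p \<noteq> 0"
  shows "zero_measure (poly p) =
    distr (density (count_space {z. poly p z = 0}) (\<lambda>z. ennreal (real (order z p)))) borel (\<lambda>z. z)"
  using assms poly_all_0_iff_0[of p] by (auto simp: zero_measure_def zorder_poly)

lemma integral_zero_measure_poly:
  fixes p :: "complex poly" and \<phi> :: "complex \<Rightarrow> real"
  assumes [measurable]: "\<phi> \<in> borel_measurable borel"
  shows "integral\<^sup>L (zero_measure (poly p)) \<phi> = (\<Sum>x\<in>#proots p. \<phi> x)"
proof (cases "p = 0")
  \<comment> \<open>The null measure matches the convention that \<open>proots 0\<close> is
    empty.\<close>
  case True
  have "integral\<^sup>L (null_measure borel) \<phi> = 0"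
    by (intro integral_eq_zero_AE AE_I[where N=UNIV]) auto
  then show ?thesis using True by (simp add: zero_measure_def)
next
  case False
  let ?Z = "{z. poly p z = 0}"
  have "integral\<^sup>L (zero_measure (poly p)) \<phi> =
      (\<integral>z. \<phi> z \<partial>density (count_space ?Z) (\<lambda>z. ennreal (real (order z p))))"
    unfolding zero_measure_poly[OF False] by (intro integral_distr) auto
  also have "\<dots> = (\<integral>z. real (order z p) *\<^sub>R \<phi> z \<partial>count_space ?Z)"
    by (intro integral_density) auto
  also have "\<dots> = (\<Sum>z\<in>?Z. real (order z p) * \<phi> z)"
    using poly_roots_finite[OF False] by (simp add: lebesgue_integral_count_space_finite)
  also have "\<dots> = (\<Sum>x\<in>#proots p. \<phi> x)"
    unfolding sum_mset_eq_sum_count using False by simp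
  finally show ?thesis .
qed

lemma emeasure_zero_measure_poly_finite:
  fixes p :: "complex poly"
  shows "emeasure (zero_measure (poly p)) A < \<infinity>"
proof (cases "p = 0")
  case True
  then show ?thesis by (simp add: zero_measure_def)
next
  case False
  let ?Z = "{z. poly p z = 0}"
  have "emeasure (zero_measure (poly p)) A \<le> emeasure (zero_measure (poly p)) (space (zero_measure (poly p)))"
    by (rule emeasure_space)
  also have "\<dots> = emeasure (density (count_space ?Z) (\<lambda>z. ennreal (real (order z p)))) ?Z"
    unfolding zero_measure_poly[OF False] by (simp add: emeasure_distr)
  also have "\<dots> = (\<Sum>z\<in>?Z. ennreal (real (order z p)))"
    using poly_roots_finite[OF False]
    by (simp add: emeasure_density nn_integral_count_space_finite)
  also have "\<dots> < \<infinity>" using poly_roots_finite[OF False] by (simp add: sum_ennreal less_top[symmetric])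
  finally show ?thesis .
qed

lemma integral_scale_measure:
  fixes f :: "'b \<Rightarrow> real"
  assumes f: "f \<in> borel_measurable M" and r: "r \<ge> 0"
  shows "integral\<^sup>L (scale_measure (ennreal r) M) f = r * integral\<^sup>L M f"
proof -
  have "scale_measure (ennreal r) M = density M (\<lambda>_. ennreal r)"
    by (rule measure_eqI) (auto simp: emeasure_density nn_integral_cmult_indicator)
  then show ?thesis using f r by (simp add: integral_density)
qed

lemma integral_uniform_circle:
  fixes \<phi> :: "complex \<Rightarrow> real"
  assumes \<phi>: "continuous_on UNIV \<phi>"
  shows "integral\<^sup>L (uniform_circle r) \<phi> = integral {0..2*pi} (\<lambda>t. \<phi> (of_real r * cis t)) / (2 * pi)"
proof -
  define f where "f t = \<phi> (of_real r * cis t)" for t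
  have path: "continuous_on A (\<lambda>t. of_real r * cis t)" for A by (intro continuous_intros)
  have f: "continuous_on A f" for A
    unfolding f_def by (intro continuous_on_compose2[OF \<phi> path]) auto
  have [measurable]: "f \<in> borel_measurable borel" "\<phi> \<in> borel_measurable borel"
    "(\<lambda>t. of_real r * cis t) \<in> borel_measurable borel"
    using f \<phi> path by (auto intro: borel_measurable_continuous_onI)
  have "(\<lambda>t. of_real r * cis t) \<in> uniform_measure lborel {0..2*pi} \<rightarrow>\<^sub>M borel" by simp
  then have "integral\<^sup>L (uniform_circle r) \<phi> = integral\<^sup>L (uniform_measure lborel {0..2*pi}) f"
    unfolding uniform_circle_def f_def by (intro integral_distr) auto
  also have "uniform_measure lborel {0..2*pi} = density lborel (\<lambda>t. ennreal (indicator {0..2*pi} t / (2*pi)))"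
    unfolding uniform_measure_def
    using divide_ennreal[of 1 "2 * pi"] by (intro density_cong) (auto split: split_indicator)
  also have "integral\<^sup>L \<dots> f = (\<integral>t. (indicator {0..2*pi} t / (2*pi)) *\<^sub>R f t \<partial>lborel)"
    by (intro integral_density) auto
  also have "\<dots> = (LINT t:{0..2*pi}|lborel. f t) / (2 * pi)"
    unfolding set_lebesgue_integral_def by simp
  also have "\<dots> = integral {0..2*pi} f / (2 * pi)"
    by (subst set_borel_integral_eq_integral) (auto intro!: borel_integrable_atLeastAtMost' f)
  finally show ?thesis by (simp add: f_def[abs_def])
qed

lemma emeasure_uniform_circle_finite: "emeasure (uniform_circle r) A < \<infinity>"
proof -
  interpret prob_space "uniform_measure lborel {0..2*pi::real}"
    by (intro prob_space_uniform_measure) auto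
  have [measurable]: "(\<lambda>t. of_real r * cis t) \<in> borel_measurable borel"
    by (intro borel_measurable_continuous_onI continuous_intros)
  have "prob_space (uniform_circle r)"
    unfolding uniform_circle_def by (intro prob_space_distr) simp
  then interpret C: prob_space "uniform_circle r" .
  show ?thesis using C.emeasure_finite by (simp add: less_top[symmetric])
qed

section \<open>Measurability of root sums\<close>

text \<open>Tychonoff's theorem, transferred from the abstract product topology to the topology of
  the function type.\<close>

lemma compact_PiE_UNIV:
  fixes S :: "'i \<Rightarrow> 'b::topological_space set"
  assumes "\<And>i. compact (S i)"
  shows "compact (PiE UNIV S)"
proof -
  have "compactin (product_topology (\<lambda>_. euclidean) UNIV) (PiE UNIV S)"
    unfolding compactin_PiE using assms by (auto simp: compactin_euclidean_iff)
  then show ?thesis by (simp add: euclidean_product_topology compactin_euclidean_iff)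
qed

lemma continuous_on_coeff_prod_linear:
  "continuous_on UNIV (\<lambda>y::nat \<Rightarrow> complex. coeff (\<Prod>j<d. [:- y j, 1:]) k)"
proof (induction d arbitrary: k)
  case (Suc d)
  have eq: "coeff (\<Prod>j<Suc d. [:- y j, 1:]) k =
      (if k = 0 then 0 else coeff (\<Prod>j<d. [:- y j, 1:]) (k - 1)) - y d * coeff (\<Prod>j<d. [:- y j, 1:]) k"
    for y :: "nat \<Rightarrow> complex"
    by (cases k) (simp_all add: mult.commute[of _ "[:_, 1:]"])
  show ?case unfolding eq
    by (cases "k = 0")
      (simp_all add: continuous_on_diff continuous_on_mult continuous_on_minus Suc.IH)
qed simp

lemma sum_proots_prod_linear:
  fixes C :: complex and \<phi> :: "complex \<Rightarrow> real" and d :: nat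
  assumes "C \<noteq> 0"
  shows "(\<Sum>x\<in>#proots (smult C (\<Prod>j<d. [:- y j, 1:])). \<phi> x) = (\<Sum>j<d. \<phi> (y j))"
  using assms by (simp add: proots_prod sum_unfold_sum_mset image_mset.compositionality o_def)

text \<open>The set is a continuous image of a compact one: the leading coefficient ranges over a
  closed bounded set, the root tuple over a closed part of a product of closed discs. Tuples are
  infinite sequences, so that one space serves all degrees.\<close>

lemma root_tuples_closed:
  fixes \<phi> :: "complex \<Rightarrow> real" and d :: nat
  assumes \<phi>: "continuous_on UNIV \<phi>"
  shows "closed ((\<lambda>(C, y) k. coeff (smult C (\<Prod>j<d. [:- y j, 1:])) k) `
    ({C. 1 / R \<le> norm C \<and> norm C \<le> R} \<times> {y. (\<forall>j. norm (y j) \<le> R) \<and> (\<Sum>j<d. \<phi> (y j)) \<le> t}))"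
    (is "closed (?f ` (?A \<times> ?B))")
proof -
  have "compact (cball 0 R \<inter> {C::complex. 1 / R \<le> norm C})"
    by (intro compact_Int_closed compact_cball closed_Collect_le continuous_intros)
  also have "cball 0 R \<inter> {C::complex. 1 / R \<le> norm C} = ?A" by auto
  finally have A: "compact ?A" .
  have "continuous_on UNIV (\<lambda>y::nat \<Rightarrow> complex. \<Sum>j<d. \<phi> (y j))"
    by (intro continuous_on_sum continuous_on_compose2[OF \<phi>] continuous_on_product_coordinates) auto
  then have "compact (PiE UNIV (\<lambda>_::nat. cball 0 R) \<inter> {y. (\<Sum>j<d. \<phi> (y j)) \<le> t})"
    by (intro compact_Int_closed compact_PiE_UNIV compact_cball closed_Collect_le continuous_on_const)
  also have "PiE UNIV (\<lambda>_::nat. cball 0 R) \<inter> {y. (\<Sum>j<d. \<phi> (y j)) \<le> t} = ?B" by (auto simp: PiE_def)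
  finally have B: "compact ?B" .
  have snd: "continuous_on UNIV (\<lambda>p::complex \<times> (nat \<Rightarrow> complex). coeff (\<Prod>j<d. [:- snd p j, 1:]) k)" for k
    by (rule continuous_on_compose2[OF continuous_on_coeff_prod_linear continuous_on_snd[OF continuous_on_id]]) simp
  have "continuous_on UNIV ?f"
    unfolding split_beta coeff_smult
    by (intro continuous_on_coordinatewise_then_product continuous_on_mult snd continuous_on_fst continuous_on_id)
  then have "compact (?f ` (?A \<times> ?B))"
    using A B by (intro compact_continuous_image compact_Times) (auto intro: continuous_on_subset)
  then show ?thesis by (rule compact_imp_closed)
qed

text \<open>
  The coefficient sequences of the polynomials with root sum at most \<open>t\<close> form a countable union of images of
  compact sets of root tuples, so no measurable selection of the roots is needed.
\<close>

lemma borel_measurable_sum_proots: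
  fixes p :: "'a \<Rightarrow> complex poly" and \<phi> :: "complex \<Rightarrow> real"
  assumes \<phi>: "continuous_on UNIV \<phi>" and p: "\<And>k. (\<lambda>\<omega>. coeff (p \<omega>) k) \<in> borel_measurable M"
  shows "(\<lambda>\<omega>. \<Sum>x\<in>#proots (p \<omega>). \<phi> x) \<in> borel_measurable M"
proof (rule borel_measurableI_le)
  fix t :: real
  define K where "K d R = (\<lambda>(C, y) k. coeff (smult C (\<Prod>j<d. [:- y j, 1:])) k) `
    ({C. 1 / R \<le> norm C \<and> norm C \<le> R} \<times> {y. (\<forall>j. norm (y j) \<le> R) \<and> (\<Sum>j<d. \<phi> (y j)) \<le> t})"
    for d :: nat and R :: real
  have "(\<lambda>\<omega>. coeff (p \<omega>)) \<in> M \<rightarrow>\<^sub>M PiM UNIV (\<lambda>_. borel)"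
    using p by (intro measurable_PiM_single') (auto simp: space_PiM)
  \<comment> \<open>Over a countable index set the product sigma-algebra is the Borel sigma-algebra
    of the product topology.\<close>
  then have coeff: "(\<lambda>\<omega>. coeff (p \<omega>)) \<in> M \<rightarrow>\<^sub>M borel"
    by (simp cong: measurable_cong_sets add: sets_PiM_equal_borel)
  \<comment> \<open>The zero polynomial needs its own clause: its root sum is \<open>0\<close>, and
    for \<open>R > 0\<close> the lower bound \<open>1 / R\<close> on the leading coefficient keeps
    it out of \<open>K d R\<close>.\<close>
  have "(\<Sum>x\<in>#proots q. \<phi> x) \<le> t \<longleftrightarrow> (q = 0 \<and> 0 \<le> t) \<or> (\<exists>d. \<exists>R::nat. R > 0 \<and> coeff q \<in> K d R)" for q
  proof (cases "q = 0")
    case True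
    have "coeff q \<notin> K d R" if "R > 0" for d and R :: real
    proof
      assume "coeff q \<in> K d R"
      then obtain C y where C: "1 / R \<le> norm C" "coeff q = (\<lambda>k. coeff (smult C (\<Prod>j<d. [:- y j, 1:])) k)"
        unfolding K_def by (auto simp del: coeff_smult)
      then have "q = smult C (\<Prod>j<d. [:- y j, 1:])" by (simp add: poly_eq_iff fun_eq_iff)
      moreover have "C \<noteq> 0" using C(1) that by (metis divide_pos_pos norm_zero not_le zero_less_one)
      ultimately show False using True by (simp add: prod_zero_iff)
    qed
    then show ?thesis using True by auto
  next
    case False
    have roots: "\<exists>d. \<exists>R::nat. R > 0 \<and> coeff q \<in> K d R" if le: "(\<Sum>x\<in>#proots q. \<phi> x) \<le> t"
    proof -
      obtain r where r: "smult (lead_coeff q) (\<Prod>j<degree q. [:- r j, 1:]) = q"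
        using complex_poly_decompose' .
      \<comment> \<open>Padding with \<open>0\<close> bounds the whole sequence, as membership in
        \<open>K\<close> demands.\<close>
      define y where "y j = (if j < degree q then r j else 0)" for j
      have y: "smult (lead_coeff q) (\<Prod>j<degree q. [:- y j, 1:]) = q"
        by (subst (2) r[symmetric]) (simp add: y_def)
      \<comment> \<open>A natural number above \<open>m\<close> bounds the leading coefficient from
        both sides and all roots at once.\<close>
      define m where "m = Max (insert (norm (lead_coeff q)) (insert (1 / norm (lead_coeff q)) ((\<lambda>j. norm (y j)) ` {..<degree q})))"
      obtain R :: nat where R: "R > m" using reals_Archimedean2 by blast
      have m: "norm (lead_coeff q) \<le> m" "1 / norm (lead_coeff q) \<le> m" "j < degree q \<Longrightarrow> norm (y j) \<le> m" for j
        unfolding m_def by (intro Max_ge; simp)+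
      have l: "norm (lead_coeff q) > 0" using False by simp
      then have "real R > 0" using m(1) R by linarith
      have "1 / norm (lead_coeff q) < R" using m(2) R by linarith
      then have "1 < R * norm (lead_coeff q)" using l by (simp only: pos_divide_less_eq)
      then have "1 / R \<le> norm (lead_coeff q)"
        using \<open>real R > 0\<close> by (simp add: pos_divide_le_eq mult.commute)
      moreover have "norm (y j) \<le> R" for j
        using m(3)[of j] R \<open>real R > 0\<close> by (cases "j < degree q") (auto simp: y_def)
      moreover have "(\<Sum>j<degree q. \<phi> (y j)) \<le> t"
        using le sum_proots_prod_linear[of "lead_coeff q" \<phi> y "degree q"] False unfolding y by simp
      ultimately have "coeff q \<in> K (degree q) R"
        unfolding K_def using m(1) R
        by (intro image_eqI[of _ _ "(lead_coeff q, y)"]) (auto simp: y simp del: coeff_smult)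
      then show ?thesis using \<open>real R > 0\<close> by auto
    qed
    have le: "(\<Sum>x\<in>#proots q. \<phi> x) \<le> t" if "R > 0" "coeff q \<in> K d R" for d and R :: nat
    proof -
      from that(2) obtain C y where C: "1 / real R \<le> norm C" "coeff q = (\<lambda>k. coeff (smult C (\<Prod>j<d. [:- y j, 1:])) k)"
        "(\<Sum>j<d. \<phi> (y j)) \<le> t"
        unfolding K_def by (auto simp del: coeff_smult)
      then have "q = smult C (\<Prod>j<d. [:- y j, 1:])" by (simp add: poly_eq_iff fun_eq_iff)
      moreover from this have "C \<noteq> 0" using False by auto
      ultimately show ?thesis using sum_proots_prod_linear C(3) by simp
    qed
    show ?thesis
    proof
      assume "(\<Sum>x\<in>#proots q. \<phi> x) \<le> t"
      from roots[OF this] show "(q = 0 \<and> 0 \<le> t) \<or> (\<exists>d. \<exists>R::nat. R > 0 \<and> coeff q \<in> K d R)" ..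
    next
      assume "(q = 0 \<and> 0 \<le> t) \<or> (\<exists>d. \<exists>R::nat. R > 0 \<and> coeff q \<in> K d R)"
      then obtain d R where "R > 0" "coeff q \<in> K d (real R)" using False by auto
      then show "(\<Sum>x\<in>#proots q. \<phi> x) \<le> t" by (rule le)
    qed
  qed
  then have "{\<omega> \<in> space M. (\<Sum>x\<in>#proots (p \<omega>). \<phi> x) \<le> t} =
      {\<omega> \<in> space M. (\<forall>k. coeff (p \<omega>) k = 0) \<and> 0 \<le> t} \<union>
      (\<Union>d. \<Union>R\<in>{0<..}. (\<lambda>\<omega>. coeff (p \<omega>)) -` K d (real R) \<inter> space M)"
    by (auto simp: poly_eq_iff)
  also have "\<dots> \<in> sets M"
  proof (intro sets.Un sets.countable_UN'')
    show "{\<omega> \<in> space M. (\<forall>k. coeff (p \<omega>) k = 0) \<and> 0 \<le> t} \<in> sets M"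
      using p by measurable
    show "(\<lambda>\<omega>. coeff (p \<omega>)) -` K d (real R) \<inter> space M \<in> sets M" for d R
      using root_tuples_closed[OF \<phi>] coeff unfolding K_def by (intro measurable_sets[of _ M borel] borel_closed)
  qed auto
  finally show "{\<omega> \<in> space M. (\<Sum>x\<in>#proots (p \<omega>). \<phi> x) \<le> t} \<in> sets M" .
qed

section \<open>Coefficient bounds in probability\<close>

text \<open>Beyond some \<open>K\<close> the limit gives
  \<open>\<bar>ln (norm (b k))\<bar> < \<epsilon> * k\<close>; the finitely many smaller indices are
  absorbed once \<open>\<epsilon> * n\<close> exceeds the constant \<open>C\<close>.\<close>

lemma uniform_subexponential:
  fixes b :: "nat \<Rightarrow> complex" and \<epsilon> :: real
  assumes b: "\<And>k. b k \<noteq> 0" and lim: "(\<lambda>k. ln (norm (b k)) / real k) \<longlonglongrightarrow> 0" and "\<epsilon> > 0"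
  shows "\<forall>\<^sub>F n in sequentially. \<forall>k\<le>n. exp (- \<epsilon> * n) \<le> norm (b k) \<and> norm (b k) \<le> exp (\<epsilon> * n)"
proof -
  obtain K where K: "\<And>k. k \<ge> K \<Longrightarrow> \<bar>ln (norm (b k)) / real k\<bar> < \<epsilon>"
    using LIMSEQ_D[OF lim \<open>\<epsilon> > 0\<close>] by (auto simp: real_norm_def)
  define C where "C = (\<Sum>k\<le>K. \<bar>ln (norm (b k))\<bar>)"
  have "\<forall>\<^sub>F n in sequentially. real n \<ge> C / \<epsilon>"
    using filterlim_real_sequentially by (simp add: filterlim_at_top)
  then show ?thesis
  proof eventually_elim
    case (elim n)
    show ?case
    proof (intro allI impI)
      fix k assume "k \<le> n"
      have "\<bar>ln (norm (b k))\<bar> \<le> \<epsilon> * n"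
      proof (cases "k \<le> K")
        case True
        then have "\<bar>ln (norm (b k))\<bar> \<le> C" unfolding C_def by (intro member_le_sum) auto
        also have "C \<le> \<epsilon> * n" using elim \<open>\<epsilon> > 0\<close> by (simp add: divide_le_eq mult.commute)
        finally show ?thesis .
      next
        case False
        then have "\<bar>ln (norm (b k))\<bar> < \<epsilon> * k" using K[of k] by (simp add: divide_less_eq)
        also have "\<epsilon> * k \<le> \<epsilon> * n" using \<open>k \<le> n\<close> \<open>\<epsilon> > 0\<close> by simp
        finally show ?thesis by simp
      qed
      moreover have "norm (b k) = exp (ln (norm (b k)))" using b by simp
      ultimately show "exp (- \<epsilon> * n) \<le> norm (b k) \<and> norm (b k) \<le> exp (\<epsilon> * n)"
        by (metis abs_le_iff exp_le_cancel_iff minus_le_iff mult_minus_left)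
    qed
  qed
qed

context prob_space
begin

text \<open>Markov's inequality for \<open>X\<close> restricted to its own tail, whose expectation
  vanishes by dominated convergence. The factor \<open>real n + 1\<close> is what a union bound over
  all coefficients costs.\<close>

lemma prob_tail_tendsto_0:
  fixes X :: "'a \<Rightarrow> real" and \<epsilon> :: real
  assumes X: "integrable M X" "\<And>\<omega>. X \<omega> \<ge> 0" and "\<epsilon> > 0"
  shows "(\<lambda>n. (real n + 1) * prob {\<omega> \<in> space M. X \<omega> > \<epsilon> * n}) \<longlonglongrightarrow> 0"
proof -
  have [measurable]: "X \<in> borel_measurable M" using X by auto
  define Y where "Y n \<omega> = X \<omega> * indicator {\<omega> \<in> space M. X \<omega> > \<epsilon> * n} \<omega>" for n :: nat and \<omega>
  have "(\<lambda>n. \<integral>\<omega>. Y n \<omega> \<partial>M) \<longlonglongrightarrow> (\<integral>\<omega>. 0 \<partial>M)"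
  proof (rule integral_dominated_convergence[where w=X])
    show "AE \<omega> in M. (\<lambda>n. Y n \<omega>) \<longlonglongrightarrow> 0"
    proof (rule AE_I2)
      fix \<omega>
      have "\<forall>\<^sub>F n in sequentially. real n \<ge> X \<omega> / \<epsilon>"
        using filterlim_real_sequentially by (simp add: filterlim_at_top)
      then have "\<forall>\<^sub>F n in sequentially. Y n \<omega> = 0"
        by eventually_elim (use \<open>\<epsilon> > 0\<close> in \<open>auto simp: Y_def divide_le_eq mult.commute split: split_indicator\<close>)
      then show "(\<lambda>n. Y n \<omega>) \<longlonglongrightarrow> 0" by (rule tendsto_eventually)
    qed
    show "AE \<omega> in M. norm (Y n \<omega>) \<le> X \<omega>" for n
      using X(2) by (auto simp: Y_def split: split_indicator)
  qed (use X in \<open>auto simp: Y_def\<close>)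
  then have lim: "(\<lambda>n. 2 / \<epsilon> * (\<integral>\<omega>. Y n \<omega> \<partial>M)) \<longlonglongrightarrow> 2 / \<epsilon> * 0"
    by (intro tendsto_mult tendsto_const) simp
  have le: "(real n + 1) * prob {\<omega> \<in> space M. X \<omega> > \<epsilon> * n} \<le> 2 / \<epsilon> * (\<integral>\<omega>. Y n \<omega> \<partial>M)" if "n > 0" for n
  proof -
    have "\<epsilon> * n * prob {\<omega> \<in> space M. X \<omega> > \<epsilon> * n} =
        (\<integral>\<omega>. \<epsilon> * n * indicator {\<omega> \<in> space M. X \<omega> > \<epsilon> * n} \<omega> \<partial>M)" by simp
    also have "\<dots> \<le> (\<integral>\<omega>. Y n \<omega> \<partial>M)"
    proof (rule integral_mono)
      show "integrable M (Y n)"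
        unfolding Y_def using X by (intro integrable_real_mult_indicator) auto
      show "\<epsilon> * n * indicator {\<omega> \<in> space M. X \<omega> > \<epsilon> * n} \<omega> \<le> Y n \<omega>" for \<omega>
        by (auto simp: Y_def split: split_indicator)
    qed (simp add: less_top[symmetric])
    finally have "real n * prob {\<omega> \<in> space M. X \<omega> > \<epsilon> * n} \<le> (\<integral>\<omega>. Y n \<omega> \<partial>M) / \<epsilon>"
      using \<open>\<epsilon> > 0\<close> by (simp add: pos_le_divide_eq mult_ac)
    moreover have "(real n + 1) * prob {\<omega> \<in> space M. X \<omega> > \<epsilon> * n} \<le> (2 * real n) * prob {\<omega> \<in> space M. X \<omega> > \<epsilon> * n}"
      using that by (intro mult_right_mono) auto
    ultimately show ?thesis by simp
  qed
  show ?thesis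
  proof (rule tendsto_sandwich[OF _ _ tendsto_const])
    show "(\<lambda>n. 2 / \<epsilon> * (\<integral>\<omega>. Y n \<omega> \<partial>M)) \<longlonglongrightarrow> 0" using lim by simp
    show "\<forall>\<^sub>F n in sequentially. (real n + 1) * prob {\<omega> \<in> space M. X \<omega> > \<epsilon> * n} \<le> 2 / \<epsilon> * (\<integral>\<omega>. Y n \<omega> \<partial>M)"
      using eventually_gt_at_top[of 0] by eventually_elim (rule le)
  qed auto
qed

text \<open>Otherwise, almost surely, \<open>norm (X \<omega>)\<close> is below
  \<open>1 / (n + 1)\<close> for all \<open>n\<close> at once, so \<open>X\<close> vanishes almost
  surely.\<close>

lemma exists_prob_norm_less_lt_1:
  fixes X :: "'a \<Rightarrow> complex"
  assumes [measurable]: "X \<in> borel_measurable M" and "\<not> (AE \<omega> in M. X \<omega> = 0)"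
  shows "\<exists>\<delta>>0. prob {\<omega> \<in> space M. norm (X \<omega>) < \<delta>} < 1"
proof (rule ccontr)
  assume none: "\<not> ?thesis"
  have "prob {\<omega> \<in> space M. norm (X \<omega>) < \<delta>} = 1" if "\<delta> > 0" for \<delta>
  proof -
    have "\<not> prob {\<omega> \<in> space M. norm (X \<omega>) < \<delta>} < 1" using none that by blast
    with prob_le_1[of "{\<omega> \<in> space M. norm (X \<omega>) < \<delta>}"] show ?thesis by linarith
  qed
  then have "AE \<omega> in M. norm (X \<omega>) < \<delta>" if "\<delta> > 0" for \<delta>
    using that by (subst (asm) prob_Collect_eq_1) auto
  then have "AE \<omega> in M. \<forall>n::nat. norm (X \<omega>) < 1 / (n + 1)"
    by (subst AE_all_countable) auto
  then have "AE \<omega> in M. X \<omega> = 0"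
  proof (rule AE_mp, intro AE_I2 impI)
    fix \<omega> assume *: "\<forall>n::nat. norm (X \<omega>) < 1 / (n + 1)"
    show "X \<omega> = 0"
    proof (rule ccontr)
      assume "X \<omega> \<noteq> 0"
      then obtain n where "1 / real (Suc n) < norm (X \<omega>)" using nat_approx_posE[of "norm (X \<omega>)"] by auto
      then show False using *[rule_format, of n] by (simp add: add.commute)
    qed
  qed
  then show False using assms by blast
qed

text \<open>By independence and equality of distributions the probability is
  \<open>p ^ card (J n)\<close> for a fixed \<open>p < 1\<close>.\<close>

lemma prob_all_less_tendsto_0:
  fixes \<xi> :: "nat \<Rightarrow> 'a \<Rightarrow> complex" and J :: "nat \<Rightarrow> nat set"
  assumes indep: "indep_vars (\<lambda>_. borel) \<xi> UNIV"
    and ident: "\<And>k. distr M borel (\<xi> k) = distr M borel (\<xi> 0)"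
    and lt: "prob {\<omega> \<in> space M. norm (\<xi> 0 \<omega>) < \<delta>} < 1"
    and J: "\<And>n. finite (J n)" "filterlim (\<lambda>n. card (J n)) at_top sequentially"
  shows "(\<lambda>n. prob {\<omega> \<in> space M. \<forall>k\<in>J n. norm (\<xi> k \<omega>) < \<delta>}) \<longlonglongrightarrow> 0"
proof -
  define p where "p = prob {\<omega> \<in> space M. norm (\<xi> 0 \<omega>) < \<delta>}"
  let ?B = "{x::complex. norm x < \<delta>}"
  have B: "?B \<in> sets borel" by measurable
  have [measurable]: "\<xi> k \<in> borel_measurable M" for k using indep by (auto simp: indep_vars_def2)
  have vimage: "\<xi> k -` ?B \<inter> space M = {\<omega> \<in> space M. norm (\<xi> k \<omega>) < \<delta>}" for k by auto
  have p: "prob (\<xi> k -` ?B \<inter> space M) = p" for k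
  proof -
    have "prob (\<xi> k -` ?B \<inter> space M) = measure (distr M borel (\<xi> k)) ?B"
      using B by (simp add: measure_distr)
    also have "\<dots> = measure (distr M borel (\<xi> 0)) ?B" by (simp only: ident[of k])
    also have "\<dots> = prob (\<xi> 0 -` ?B \<inter> space M)" using B by (simp add: measure_distr)
    also have "\<dots> = p" unfolding vimage p_def ..
    finally show ?thesis .
  qed
  have eq: "prob {\<omega> \<in> space M. \<forall>k\<in>J n. norm (\<xi> k \<omega>) < \<delta>} = p ^ card (J n)" for n
  proof (cases "J n = {}")
    case True
    then show ?thesis by (simp add: prob_space)
  next
    case False
    have "prob (\<Inter>k\<in>J n. \<xi> k -` ?B \<inter> space M) = (\<Prod>k\<in>J n. prob (\<xi> k -` ?B \<inter> space M))"
    proof (rule indep_setsD)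
      show "indep_sets (\<lambda>k. {\<xi> k -` A \<inter> space M |A. A \<in> sets borel}) UNIV"
        using indep by (simp add: indep_vars_def2)
      show "\<forall>k\<in>J n. \<xi> k -` ?B \<inter> space M \<in> {\<xi> k -` A \<inter> space M |A. A \<in> sets borel}"
        using B by blast
    qed (use J(1) False in auto)
    also have "(\<Inter>k\<in>J n. \<xi> k -` ?B \<inter> space M) = {\<omega> \<in> space M. \<forall>k\<in>J n. norm (\<xi> k \<omega>) < \<delta>}"
      using False by auto
    finally show ?thesis by (simp only: p prod_constant)
  qed
  have "(\<lambda>n. p ^ n) \<longlonglongrightarrow> 0"
    using lt by (intro LIMSEQ_realpow_zero) (auto simp: p_def)
  from filterlim_compose[OF this J(2)] show ?thesis by (simp add: eq)
qed

text \<open>For large \<open>n\<close> failure forces one of three rare events: some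
  \<open>\<xi> k\<close> is exponentially large (\<open>U n\<close>, by a union bound and the
  logarithmic moment), or all \<open>\<xi> k\<close> in the low or in the high index window are
  below \<open>\<delta>\<close>.\<close>

lemma coeff_bounds_in_probability:
  fixes \<xi> :: "nat \<Rightarrow> 'a \<Rightarrow> complex" and b :: "nat \<Rightarrow> complex" and \<epsilon> :: real
  assumes indep: "indep_vars (\<lambda>_. borel) \<xi> UNIV"
    and ident: "\<And>k. distr M borel (\<xi> k) = distr M borel (\<xi> 0)"
    and nontrivial: "\<not> (AE \<omega> in M. \<xi> 0 \<omega> = 0)"
    and log_moment: "integrable M (\<lambda>\<omega>. ln (1 + norm (\<xi> 0 \<omega>)))"
    and b: "\<And>k. b k \<noteq> 0" and b_lim: "(\<lambda>k. ln (norm (b k)) / real k) \<longlonglongrightarrow> 0"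
    and \<epsilon>: "\<epsilon> > 0"
  shows "(\<lambda>n. prob {\<omega> \<in> space M. \<not> (
      (\<forall>k\<le>n. norm (\<xi> k \<omega> * b k) \<le> exp (\<epsilon> * n)) \<and>
      (\<exists>k\<le>n. real k \<le> \<epsilon> * n \<and> exp (- \<epsilon> * n) \<le> norm (\<xi> k \<omega> * b k)) \<and>
      (\<exists>k\<le>n. (1 - \<epsilon>) * n \<le> real k \<and> exp (- \<epsilon> * n) \<le> norm (\<xi> k \<omega> * b k)))}) \<longlonglongrightarrow> 0"
    (is "?P \<longlonglongrightarrow> 0")
proof -
  have [measurable]: "\<xi> k \<in> borel_measurable M" for k using indep by (auto simp: indep_vars_def2)
  obtain \<delta> where \<delta>: "\<delta> > 0" "prob {\<omega> \<in> space M. norm (\<xi> 0 \<omega>) < \<delta>} < 1"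
    using exists_prob_norm_less_lt_1[OF _ nontrivial] by auto
  define J1 J2 where "J1 n = {k. k \<le> n \<and> real k \<le> \<epsilon> * n}" and "J2 n = {k. k \<le> n \<and> (1 - \<epsilon>) * n \<le> real k}"
    for n :: nat
  have fin: "finite (J1 n)" "finite (J2 n)" for n
    by (auto simp: J1_def J2_def intro: finite_subset[of _ "{..n}"])
  have ev: "\<forall>\<^sub>F n in sequentially. n \<ge> m \<and> \<epsilon> * real n \<ge> real m" for m :: nat
  proof (intro eventually_conj eventually_ge_at_top)
    have "\<forall>\<^sub>F n in sequentially. real n \<ge> m / \<epsilon>"
      using filterlim_real_sequentially by (simp add: filterlim_at_top)
    then show "\<forall>\<^sub>F n in sequentially. \<epsilon> * real n \<ge> real m"
      by eventually_elim (use \<epsilon> in \<open>simp add: divide_le_eq mult.commute\<close>)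
  qed
  have card1: "filterlim (\<lambda>n. card (J1 n)) at_top sequentially"
    unfolding filterlim_at_top
  proof
    fix m show "\<forall>\<^sub>F n in sequentially. m \<le> card (J1 n)"
      using ev[of m]
    proof eventually_elim
      case (elim n)
      then have "{..<m} \<subseteq> J1 n" by (auto simp: J1_def)
      from card_mono[OF fin(1) this] show ?case by simp
    qed
  qed
  have card2: "filterlim (\<lambda>n. card (J2 n)) at_top sequentially"
    unfolding filterlim_at_top
  proof
    fix m show "\<forall>\<^sub>F n in sequentially. m \<le> card (J2 n)"
      using ev[of m]
    proof eventually_elim
      case (elim n)
      then have "{n - m..<n} \<subseteq> J2 n"
        by (auto simp: J2_def left_diff_distrib of_nat_diff)
      from card_mono[OF fin(2) this] show ?case using elim by simp
    qed
  qed
  define T where "T n = {\<omega> \<in> space M. ln (1 + norm (\<xi> 0 \<omega>)) > \<epsilon> / 2 * n}" for n :: nat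
  define A where "A J = {\<omega> \<in> space M. \<forall>k\<in>J. norm (\<xi> k \<omega>) < \<delta>}" for J :: "nat set"
  define U where "U n = {\<omega> \<in> space M. \<exists>k\<le>n. ln (1 + norm (\<xi> k \<omega>)) > \<epsilon> / 2 * n}" for n :: nat
  have [measurable]: "T n \<in> events" "U n \<in> events" for n by (simp_all add: T_def U_def)
  have A_meas[measurable]: "A (J1 n) \<in> events" "A (J2 n) \<in> events" for n
    using fin by (auto simp: A_def)
  have U_le: "prob (U n) \<le> (real n + 1) * prob (T n)" for n
  proof -
    let ?B = "{x::complex. ln (1 + norm x) > \<epsilon> / 2 * n}"
    have B: "?B \<in> sets borel" by measurable
    have "U n = (\<Union>k\<in>{..n}. \<xi> k -` ?B \<inter> space M)" by (auto simp: U_def)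
    moreover have "\<xi> k -` ?B \<inter> space M \<in> events" for k using B by (rule measurable_sets[rotated]) simp
    ultimately have "prob (U n) \<le> (\<Sum>k\<le>n. prob (\<xi> k -` ?B \<inter> space M))"
      by (simp only: finite_atMost finite_measure_subadditive_finite image_subsetI)
    also have "\<dots> = (\<Sum>k\<le>n. prob (T n))"
    proof (rule sum.cong[OF refl])
      fix k
      have "prob (\<xi> k -` ?B \<inter> space M) = measure (distr M borel (\<xi> k)) ?B"
        using B by (simp add: measure_distr)
      also have "\<dots> = measure (distr M borel (\<xi> 0)) ?B" by (simp only: ident[of k])
      also have "\<dots> = prob (\<xi> 0 -` ?B \<inter> space M)" using B by (simp add: measure_distr)
      also have "\<xi> 0 -` ?B \<inter> space M = T n" by (auto simp: T_def)
      finally show "prob (\<xi> k -` ?B \<inter> space M) = prob (T n)" .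
    qed
    finally show ?thesis by (simp add: add.commute)
  qed
  have T_lim: "(\<lambda>n. (real n + 1) * prob (T n)) \<longlonglongrightarrow> 0"
    unfolding T_def by (rule prob_tail_tendsto_0[OF log_moment]) (use \<epsilon> in auto)
  have "(\<lambda>n. prob (A (J n))) \<longlonglongrightarrow> 0"
    if "\<And>n. finite (J n)" "filterlim (\<lambda>n. card (J n)) at_top sequentially" for J
    unfolding A_def by (rule prob_all_less_tendsto_0[OF indep ident \<delta>(2) that])
  note A_lim = this[OF fin(1) card1] this[OF fin(2) card2]
  have "(\<lambda>n. (real n + 1) * prob (T n) + prob (A (J1 n)) + prob (A (J2 n))) \<longlonglongrightarrow> 0 + 0 + 0"
    by (intro tendsto_add T_lim A_lim)
  then have lim: "(\<lambda>n. (real n + 1) * prob (T n) + prob (A (J1 n)) + prob (A (J2 n))) \<longlonglongrightarrow> 0" by simp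
  have "\<forall>\<^sub>F n in sequentially. ln (1 / \<delta>) \<le> \<epsilon> / 2 * real n"
  proof -
    have "\<forall>\<^sub>F n in sequentially. real n \<ge> ln (1 / \<delta>) / (\<epsilon> / 2)"
      using filterlim_real_sequentially unfolding filterlim_at_top by blast
    then show ?thesis by eventually_elim (use \<epsilon> in \<open>simp add: divide_le_eq mult.commute\<close>)
  qed
  moreover have "\<epsilon> / 2 > 0" using \<epsilon> by simp
  note uniform_subexponential[OF b b_lim this]
  ultimately have "\<forall>\<^sub>F n in sequentially. ?P n \<le> (real n + 1) * prob (T n) + prob (A (J1 n)) + prob (A (J2 n))"
  proof eventually_elim
    case (elim n)
    \<comment> \<open>The exponent \<open>\<epsilon> * n\<close> is split evenly between
      \<open>\<xi> k\<close> and \<open>b k\<close>.\<close>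
    have half: "exp (- \<epsilon> / 2 * n) * exp (- \<epsilon> / 2 * n) = exp (- \<epsilon> * n)" "exp (\<epsilon> / 2 * n) * exp (\<epsilon> / 2 * n) = exp (\<epsilon> * n)"
      by (simp_all add: exp_add[symmetric])
    have \<delta>_ge: "exp (- \<epsilon> / 2 * n) \<le> \<delta>"
    proof -
      have "- (\<epsilon> / 2 * n) \<le> ln \<delta>" using elim(1) \<delta>(1) by (simp add: ln_div)
      then have "exp (- (\<epsilon> / 2 * n)) \<le> exp (ln \<delta>)" by (simp only: exp_le_cancel_iff)
      then show ?thesis using \<delta>(1) by simp
    qed
    have large: "exp (- \<epsilon> * n) \<le> norm (\<xi> k \<omega> * b k)" if "\<delta> \<le> norm (\<xi> k \<omega>)" "k \<le> n" for k \<omega>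
    proof -
      have "exp (- \<epsilon> / 2 * n) * exp (- \<epsilon> / 2 * n) \<le> norm (\<xi> k \<omega>) * norm (b k)"
        using that \<delta>_ge elim(2) \<delta>(1) by (intro mult_mono) auto
      then show ?thesis by (simp only: half norm_mult)
    qed
    have small: "norm (\<xi> k \<omega> * b k) \<le> exp (\<epsilon> * n)" if "ln (1 + norm (\<xi> k \<omega>)) \<le> \<epsilon> / 2 * n" "k \<le> n" for k \<omega>
    proof -
      have "exp (ln (1 + norm (\<xi> k \<omega>))) \<le> exp (\<epsilon> / 2 * n)" using that by (simp only: exp_le_cancel_iff)
      then have "norm (\<xi> k \<omega>) \<le> exp (\<epsilon> / 2 * n)"
        by (subst (asm) exp_ln) (auto simp: add_pos_nonneg intro: order_trans[rotated])
      then have "norm (\<xi> k \<omega>) * norm (b k) \<le> exp (\<epsilon> / 2 * n) * exp (\<epsilon> / 2 * n)"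
        using that elim(2) by (intro mult_mono) auto
      then show ?thesis by (simp only: half norm_mult)
    qed
    have "?P n \<le> prob (U n \<union> A (J1 n) \<union> A (J2 n))"
    proof (rule finite_measure_mono)
      show "{\<omega> \<in> space M. \<not> (
      (\<forall>k\<le>n. norm (\<xi> k \<omega> * b k) \<le> exp (\<epsilon> * n)) \<and>
      (\<exists>k\<le>n. real k \<le> \<epsilon> * n \<and> exp (- \<epsilon> * n) \<le> norm (\<xi> k \<omega> * b k)) \<and>
      (\<exists>k\<le>n. (1 - \<epsilon>) * n \<le> real k \<and> exp (- \<epsilon> * n) \<le> norm (\<xi> k \<omega> * b k)))} \<subseteq> U n \<union> A (J1 n) \<union> A (J2 n)"
      proof (intro subsetI, rule ccontr)
        fix \<omega> assume \<omega>: "\<omega> \<in> {\<omega> \<in> space M. \<not> (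
      (\<forall>k\<le>n. norm (\<xi> k \<omega> * b k) \<le> exp (\<epsilon> * n)) \<and>
      (\<exists>k\<le>n. real k \<le> \<epsilon> * n \<and> exp (- \<epsilon> * n) \<le> norm (\<xi> k \<omega> * b k)) \<and>
      (\<exists>k\<le>n. (1 - \<epsilon>) * n \<le> real k \<and> exp (- \<epsilon> * n) \<le> norm (\<xi> k \<omega> * b k)))}"
          and notin: "\<omega> \<notin> U n \<union> A (J1 n) \<union> A (J2 n)"
        have sp: "\<omega> \<in> space M" using \<omega> by simp
        have "\<forall>k\<le>n. norm (\<xi> k \<omega> * b k) \<le> exp (\<epsilon> * n)"
          using notin sp small by (auto simp: U_def not_less)
        moreover have "\<exists>k\<le>n. real k \<le> \<epsilon> * n \<and> exp (- \<epsilon> * n) \<le> norm (\<xi> k \<omega> * b k)"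
        proof -
          obtain k where "k \<in> J1 n" "\<delta> \<le> norm (\<xi> k \<omega>)" using notin sp by (auto simp: A_def not_less)
          then show ?thesis using large by (auto simp: J1_def)
        qed
        moreover have "\<exists>k\<le>n. (1 - \<epsilon>) * n \<le> real k \<and> exp (- \<epsilon> * n) \<le> norm (\<xi> k \<omega> * b k)"
        proof -
          obtain k where "k \<in> J2 n" "\<delta> \<le> norm (\<xi> k \<omega>)" using notin sp by (auto simp: A_def not_less)
          then show ?thesis using large by (auto simp: J2_def)
        qed
        ultimately show False using \<omega> by blast
      qed
    qed auto
    also have "\<dots> \<le> prob (U n) + prob (A (J1 n)) + prob (A (J2 n))"
      by (intro order_trans[OF measure_Un_le] add_right_mono measure_Un_le) auto
    finally show ?case using U_le[of n] by linarith
  qed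
  then show ?thesis
    by (intro tendsto_sandwich[OF _ _ tendsto_const lim]) auto
qed

end

section \<open>Convergence of zero measures\<close>

lemma test_function_bounded:
  assumes "test_function \<phi>"
  shows "\<exists>C. \<forall>x. \<bar>\<phi> x\<bar> \<le> C"
proof -
  have \<phi>: "continuous_on UNIV \<phi>" "compact (closure {z. \<phi> z \<noteq> 0})"
    using assms by (auto simp: test_function_def)
  then have "compact (\<phi> ` closure {z. \<phi> z \<noteq> 0})"
    by (intro compact_continuous_image continuous_on_subset[OF \<phi>(1)]) auto
  then obtain C where C: "\<forall>x\<in>closure {z. \<phi> z \<noteq> 0}. \<bar>\<phi> x\<bar> \<le> C"
    by (auto dest!: compact_imp_bounded simp: bounded_iff)
  have "\<bar>\<phi> x\<bar> \<le> max C 0" for x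
  proof (cases "\<phi> x = 0")
    case False
    then have "x \<in> closure {z. \<phi> z \<noteq> 0}" by (intro subsetD[OF closure_subset]) simp
    from C[rule_format, OF this] show ?thesis by simp
  qed simp
  then show ?thesis by (intro exI allI)
qed

definition coeff_bounds :: "real \<Rightarrow> nat \<Rightarrow> (nat \<Rightarrow> complex) \<Rightarrow> bool" where
  "coeff_bounds \<epsilon> n a \<longleftrightarrow>
     (\<forall>k\<le>n. norm (a k) \<le> exp (\<epsilon> * n)) \<and>
     (\<exists>k\<le>n. real k \<le> \<epsilon> * n \<and> exp (- \<epsilon> * n) \<le> norm (a k)) \<and>
     (\<exists>k\<le>n. (1 - \<epsilon>) * n \<le> real k \<and> exp (- \<epsilon> * n) \<le> norm (a k))"

lemma coeff_bounds_mono: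
  assumes "coeff_bounds \<delta> n a" "\<delta> \<le> \<epsilon>"
  shows "coeff_bounds \<epsilon> n a"
proof -
  have le: "\<delta> * n \<le> \<epsilon> * n" using assms(2) by (intro mult_right_mono) auto
  then have e: "exp (\<delta> * n) \<le> exp (\<epsilon> * n)" "exp (- \<epsilon> * n) \<le> exp (- \<delta> * n)" by auto
  have l: "(1 - \<epsilon>) * n \<le> (1 - \<delta>) * n" using assms(2) by (intro mult_right_mono) auto
  show ?thesis
    using assms(1) le e l unfolding coeff_bounds_def by (meson order_trans)
qed

text \<open>Dividing the roots by \<open>s\<close> multiplies the \<open>k\<close>-th coefficient by
  \<open>s ^ k\<close> and turns the circle of radius \<open>s\<close> into the unit circle, so that
  the deterministic setting applies. The factor \<open>s ^ d i\<close> in \<open>c i\<close> belongs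
  to the leading coefficient.\<close>

lemma sum_proots_mean_tendsto:
  fixes a :: "nat \<Rightarrow> nat \<Rightarrow> complex" and \<phi> :: "complex \<Rightarrow> real"
  assumes n: "filterlim n at_top sequentially" and s: "s > 0"
    and bounds: "\<And>\<epsilon>. \<epsilon> > 0 \<Longrightarrow> \<forall>\<^sub>F i in sequentially. coeff_bounds \<epsilon> (n i) (\<lambda>k. a i k * of_real s ^ k)"
    and \<phi>: "continuous_on UNIV \<phi>" "\<And>x. \<bar>\<phi> x\<bar> \<le> C"
  shows "(\<lambda>i. (\<Sum>x\<in>#proots (\<Sum>k\<le>n i. monom (a i k) k). \<phi> x) / n i)
           \<longlonglongrightarrow> integral {0..2*pi} (\<lambda>t. \<phi> (of_real s * cis t)) / (2 * pi)"
proof -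
  define q where "q i = (\<Sum>k\<le>n i. monom (a i k) k)" for i
  define d where "d i = degree (q i)" for i
  have "\<exists>y. smult (lead_coeff (q i)) (\<Prod>j<degree (q i). [:- y j, 1:]) = q i" for i
    using complex_poly_decompose' by metis
  then obtain y where y: "\<And>i. smult (lead_coeff (q i)) (\<Prod>j<d i. [:- y i j, 1:]) = q i"
    unfolding d_def by metis
  define z where "z i j = y i j / of_real s" for i j
  define c where "c i = lead_coeff (q i) * of_real s ^ d i" for i
  define P where "P = (\<lambda>i. smult (c i) (\<Prod>j<d i. [:- z i j, 1:]))"
  have "poly (P i) x = poly (\<Sum>k\<le>n i. monom (a i k * of_real s ^ k) k) x" for i x
  proof -
    have "poly (P i) x = lead_coeff (q i) * (\<Prod>j<d i. of_real s * (x - z i j))"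
      by (simp add: P_def c_def poly_prod prod.distrib)
    also have "\<dots> = lead_coeff (q i) * (\<Prod>j<d i. of_real s * x - y i j)"
      using s by (simp add: z_def right_diff_distrib)
    also have "\<dots> = poly (q i) (of_real s * x)"
      by (subst (2) y[symmetric]) (simp add: poly_prod)
    also have "\<dots> = poly (\<Sum>k\<le>n i. monom (a i k * of_real s ^ k) k) x"
      by (simp add: q_def poly_sum poly_monom power_mult_distrib mult_ac)
    finally show ?thesis .
  qed
  then have P: "P i = (\<Sum>k\<le>n i. monom (a i k * of_real s ^ k) k)" for i
    by (simp add: poly_eq_poly_eq_iff[symmetric] fun_eq_iff)
  have coeff_P: "coeff (P i) k = (if k \<le> n i then a i k * of_real s ^ k else 0)" for i k
    by (simp add: P coeff_sum)
  have "root_asymptotics sequentially n d c z"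
  proof
    show "d i \<le> n i" for i
      unfolding d_def q_def by (intro degree_sum_le) (auto intro: order_trans[OF degree_monom_le])
    fix \<epsilon> :: real assume "\<epsilon> > 0"
    note ev = bounds[OF this]
    have "\<forall>\<^sub>F i in sequentially. \<forall>k. norm (coeff (P i) k) \<le> exp (\<epsilon> * n i)"
      using ev by eventually_elim (auto simp: coeff_bounds_def coeff_P)
    then show "\<forall>\<^sub>F i in sequentially. \<forall>k. norm (coeff (smult (c i) (\<Prod>j<d i. [:- z i j, 1:])) k) \<le> exp (\<epsilon> * n i)"
      by (simp only: P_def)
    have "\<forall>\<^sub>F i in sequentially. \<exists>k. real k \<le> \<epsilon> * n i \<and> exp (- \<epsilon> * n i) \<le> norm (coeff (P i) k)"
      using ev by eventually_elim (auto simp: coeff_bounds_def coeff_P)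
    then show "\<forall>\<^sub>F i in sequentially. \<exists>k. real k \<le> \<epsilon> * n i \<and>
        exp (- \<epsilon> * n i) \<le> norm (coeff (smult (c i) (\<Prod>j<d i. [:- z i j, 1:])) k)"
      by (simp only: P_def)
    have "\<forall>\<^sub>F i in sequentially. \<exists>k. (1 - \<epsilon>) * n i \<le> real k \<and> exp (- \<epsilon> * n i) \<le> norm (coeff (P i) k)"
      using ev by eventually_elim (auto simp: coeff_bounds_def coeff_P)
    then show "\<forall>\<^sub>F i in sequentially. \<exists>k. (1 - \<epsilon>) * n i \<le> real k \<and>
        exp (- \<epsilon> * n i) \<le> norm (coeff (smult (c i) (\<Prod>j<d i. [:- z i j, 1:])) k)"
      by (simp only: P_def)
  qed (rule n)
  then interpret root_asymptotics sequentially n d c z P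
    by (simp_all add: P_def)
  have "continuous_on UNIV (\<lambda>x. \<phi> (of_real s * x))"
    by (intro continuous_on_compose2[OF \<phi>(1)] continuous_intros) auto
  from root_mean_tendsto[OF this \<phi>(2)]
  have "(\<lambda>i. (\<Sum>j<d i. \<phi> (y i j)) / n i) \<longlonglongrightarrow> integral {0..2*pi} (\<lambda>t. \<phi> (of_real s * cis t)) / (2 * pi)"
    using s by (simp add: z_def)
  moreover have "(\<Sum>x\<in>#proots (q i). \<phi> x) = (\<Sum>j<d i. \<phi> (y i j))" if "c i \<noteq> 0" for i
  proof -
    have "lead_coeff (q i) \<noteq> 0" using that by (simp add: c_def)
    from sum_proots_prod_linear[OF this, of \<phi> "y i" "d i"] show ?thesis by (simp only: y)
  qed
  ultimately show ?thesis
    unfolding q_def[symmetric]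
    by (elim Lim_transform_eventually) (use eventually_c_nonzero in \<open>auto elim: eventually_mono\<close>)
qed

theorem theorem2p2:
  fixes M :: "'a measure"
    and \<xi> :: "nat \<Rightarrow> 'a \<Rightarrow> complex"
    and w :: "nat \<Rightarrow> complex"
    and c :: real
  assumes "prob_space M"
    and indep: "prob_space.indep_vars M (\<lambda>_. borel) \<xi> UNIV"
    and ident: "\<And>k. distr M borel (\<xi> k) = distr M borel (\<xi> 0)"
    and nondegenerate: "\<And>k. \<not> (\<exists>a. AE \<omega> in M. \<xi> k \<omega> = a)"
    and log_moment: "integrable M (\<lambda>\<omega>. ln (1 + norm (\<xi> 0 \<omega>)))"
    and w_nonzero: "\<And>k. w k \<noteq> 0"
    and w_limit: "(\<lambda>k. ln (norm (w k)) / real k) \<longlonglongrightarrow> c"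
  shows "measures_converge_in_probability M
           (\<lambda>n \<omega>. scale_measure (ennreal (1 / real n)) (zero_measure (random_polynomial \<xi> w n \<omega>)))
           (\<lambda>_. uniform_circle (exp (- c)))"
proof -
  interpret prob_space M by fact
  have [measurable]: "\<xi> k \<in> borel_measurable M" for k using indep by (auto simp: indep_vars_def2)
  define q where "q n \<omega> = (\<Sum>k\<le>n. monom (\<xi> k \<omega> * w k) k)" for n \<omega>
  have poly_q: "random_polynomial \<xi> w n \<omega> = poly (q n \<omega>)" for n \<omega>
    by (simp add: fun_eq_iff random_polynomial_def q_def poly_sum poly_monom)
  have coeff_q: "(\<lambda>\<omega>. coeff (q n \<omega>) k) \<in> borel_measurable M" for n k
    by (simp add: q_def coeff_sum)
  let ?\<nu> = "\<lambda>n \<omega>. scale_measure (ennreal (1 / real n)) (zero_measure (poly (q n \<omega>)))"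
  \<comment> \<open>For \<open>n = 0\<close> both sides are \<open>0\<close>, since
    \<open>1 / 0 = 0\<close>.\<close>
  have integral: "integral\<^sup>L (?\<nu> n \<omega>) \<phi> = (\<Sum>x\<in>#proots (q n \<omega>). \<phi> x) / n"
    if "continuous_on UNIV \<phi>" for n \<omega> and \<phi> :: "complex \<Rightarrow> real"
  proof -
    have "\<phi> \<in> borel_measurable borel" using that by (rule borel_measurable_continuous_onI)
    then show ?thesis
      by (subst integral_scale_measure) (auto simp: integral_zero_measure_poly cong: measurable_cong_sets)
  qed
  have measurable_integral: "(\<lambda>\<omega>. integral\<^sup>L (?\<nu> n \<omega>) \<phi>) \<in> borel_measurable M" if "continuous_on UNIV \<phi>"
    for n and \<phi> :: "complex \<Rightarrow> real"
    unfolding integral[OF that]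
    by (intro borel_measurable_divide borel_measurable_sum_proots that coeff_q) simp
  have random: "random_measure M (?\<nu> n)" for n
    unfolding random_measure_def test_function_def
    using emeasure_zero_measure_poly_finite
    by (auto intro: measurable_integral simp: ennreal_mult_less_top)
  have random_circle: "random_measure M (\<lambda>_. uniform_circle (exp (- c)))"
    unfolding random_measure_def using emeasure_uniform_circle_finite[of "exp (- c)"]
    by (auto simp: uniform_circle_def)
  \<comment> \<open>The rescaling by the limit radius \<open>exp (- c)\<close> removes the
    exponential rate \<open>c\<close> of the weights.\<close>
  define b where "b k = w k * of_real (exp (- c)) ^ k" for k
  have b: "b k \<noteq> 0" for k by (simp add: b_def w_nonzero)
  have "(\<lambda>k. ln (norm (w k)) / real k - c) \<longlonglongrightarrow> c - c" by (intro tendsto_intros w_limit)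
  moreover have "\<forall>\<^sub>F k in sequentially. ln (norm (w k)) / real k - c = ln (norm (b k)) / real k"
    using eventually_gt_at_top[of 0]
    by eventually_elim (simp add: b_def norm_mult norm_power ln_mult_pos ln_realpow w_nonzero field_simps)
  ultimately have b_lim: "(\<lambda>k. ln (norm (b k)) / real k) \<longlonglongrightarrow> 0"
    by (simp add: Lim_transform_eventually)
  have nontrivial: "\<not> (AE \<omega> in M. \<xi> 0 \<omega> = 0)" using nondegenerate by blast
  have conv: "(\<lambda>n. prob {\<omega> \<in> space M. \<bar>integral\<^sup>L (?\<nu> n \<omega>) \<phi> - integral\<^sup>L (uniform_circle (exp (- c))) \<phi>\<bar> > e}) \<longlonglongrightarrow> 0"
    if \<phi>: "test_function \<phi>" and e: "e > 0" for \<phi> e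
  proof -
    have cont: "continuous_on UNIV \<phi>" using \<phi> by (simp add: test_function_def)
    obtain C where C: "\<And>x. \<bar>\<phi> x\<bar> \<le> C" using test_function_bounded[OF \<phi>] by blast
    define X where "X n \<omega> = \<bar>(\<Sum>x\<in>#proots (q n \<omega>). \<phi> x) / n - integral\<^sup>L (uniform_circle (exp (- c))) \<phi>\<bar>" for n \<omega>
    \<comment> \<open>The deterministic limit theorem concerns single sequences, but a bound uniform
      in \<open>\<omega>\<close> is needed. If none existed, there would be
      \<open>n i \<ge> i\<close> and \<open>\<omega> i\<close> satisfying the coefficient bounds
      with \<open>1 / (i + 1)\<close> and still violating the conclusion; by monotonicity this
      sequence satisfies the bounds eventually for every \<open>\<epsilon>\<close>, against the
      limit theorem.\<close>
    have "\<exists>\<epsilon>>0. \<exists>N. \<forall>n\<ge>N. \<forall>\<omega>. coeff_bounds \<epsilon> n (\<lambda>k. \<xi> k \<omega> * b k) \<longrightarrow> X n \<omega> \<le> e"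
    proof (rule ccontr)
      assume "\<not> ?thesis"
      then have none: "\<forall>\<epsilon>>0. \<forall>N. \<exists>n\<ge>N. \<exists>\<omega>. coeff_bounds \<epsilon> n (\<lambda>k. \<xi> k \<omega> * b k) \<and> e < X n \<omega>"
        by (simp add: not_le)
      have "\<exists>n \<omega>. n \<ge> i \<and> coeff_bounds (1 / (i + 1)) n (\<lambda>k. \<xi> k \<omega> * b k) \<and> X n \<omega> > e" for i :: nat
        using none[rule_format, of "1 / (real i + 1)" i] by (auto simp: add.commute)
      then obtain n \<omega> where n\<omega>: "\<And>i::nat. n i \<ge> i" "\<And>i. X (n i) (\<omega> i) > e"
        "\<And>i::nat. coeff_bounds (1 / (i + 1)) (n i) (\<lambda>k. \<xi> k (\<omega> i) * b k)"
        by metis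
      have "(\<lambda>i. (\<Sum>x\<in>#proots (\<Sum>k\<le>n i. monom (\<xi> k (\<omega> i) * w k) k). \<phi> x) / n i)
           \<longlonglongrightarrow> integral {0..2*pi} (\<lambda>t. \<phi> (of_real (exp (- c)) * cis t)) / (2 * pi)"
      proof (rule sum_proots_mean_tendsto)
        show "filterlim n at_top sequentially"
          using n\<omega>(1) by (intro filterlim_at_top_mono[OF filterlim_ident]) auto
        fix \<epsilon> :: real assume "\<epsilon> > 0"
        then obtain N where N: "1 / real (Suc N) < \<epsilon>" using nat_approx_posE by blast
        show "\<forall>\<^sub>F i in sequentially. coeff_bounds \<epsilon> (n i) (\<lambda>k. \<xi> k (\<omega> i) * w k * of_real (exp (- c)) ^ k)"
          using eventually_ge_at_top[of N]
        proof eventually_elim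
          case (elim i)
          have "1 / (real i + 1) \<le> 1 / real (Suc N)" using elim by (simp add: frac_le)
          with N have "1 / (i + 1) \<le> \<epsilon>" by (simp add: add.commute)
          from coeff_bounds_mono[OF n\<omega>(3)[of i] this] show ?case
            by (simp only: b_def mult.assoc)
        qed
      qed (use cont C in auto)
      then have "(\<lambda>i. (\<Sum>x\<in>#proots (q (n i) (\<omega> i)). \<phi> x) / n i) \<longlonglongrightarrow> integral\<^sup>L (uniform_circle (exp (- c))) \<phi>"
        by (simp only: q_def integral_uniform_circle[OF cont])
      from eventually_happens'[OF sequentially_bot tendstoD[OF this e]]
      obtain i where "X (n i) (\<omega> i) < e" unfolding X_def dist_real_def ..
      with n\<omega>(2)[of i] show False by simp
    qed
    then obtain \<epsilon> N where \<epsilon>: "\<epsilon> > 0"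
      and N: "\<And>n \<omega>. n \<ge> N \<Longrightarrow> coeff_bounds \<epsilon> n (\<lambda>k. \<xi> k \<omega> * b k) \<Longrightarrow> X n \<omega> \<le> e" by blast
    have lim: "(\<lambda>n. prob {\<omega> \<in> space M. \<not> coeff_bounds \<epsilon> n (\<lambda>k. \<xi> k \<omega> * b k)}) \<longlonglongrightarrow> 0"
      unfolding coeff_bounds_def
      by (rule coeff_bounds_in_probability[OF indep ident nontrivial log_moment b b_lim \<epsilon>])
    have "\<forall>\<^sub>F n in sequentially. prob {\<omega> \<in> space M. X n \<omega> > e} \<le>
        prob {\<omega> \<in> space M. \<not> coeff_bounds \<epsilon> n (\<lambda>k. \<xi> k \<omega> * b k)}"
      using eventually_ge_at_top[of N]
    proof eventually_elim
      case (elim n)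
      show ?case
      proof (rule finite_measure_mono)
        show "{\<omega> \<in> space M. X n \<omega> > e} \<subseteq> {\<omega> \<in> space M. \<not> coeff_bounds \<epsilon> n (\<lambda>k. \<xi> k \<omega> * b k)}"
          using N[OF elim] by (auto simp: not_le[symmetric])
        show "{\<omega> \<in> space M. \<not> coeff_bounds \<epsilon> n (\<lambda>k. \<xi> k \<omega> * b k)} \<in> events"
          unfolding coeff_bounds_def by measurable
      qed
    qed
    then have "(\<lambda>n. prob {\<omega> \<in> space M. X n \<omega> > e}) \<longlonglongrightarrow> 0"
      by (intro tendsto_sandwich[OF _ _ tendsto_const lim]) auto
    then show ?thesis by (simp only: X_def integral[OF cont])
  qed
  show ?thesis
    unfolding measures_converge_in_probability_def converges_in_probability_def poly_q
  proof (intro conjI allI impI)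
    show "random_measure M (?\<nu> n)" for n by (rule random)
    show "random_measure M (\<lambda>_. uniform_circle (exp (- c)))" by (rule random_circle)
    fix \<phi> assume \<phi>: "test_function \<phi>"
    show "(\<lambda>\<omega>. integral\<^sup>L (?\<nu> n \<omega>) \<phi>) \<in> borel_measurable M" for n
      using \<phi> by (intro measurable_integral) (simp add: test_function_def)
    show "(\<lambda>\<omega>. integral\<^sup>L (uniform_circle (exp (- c))) \<phi>) \<in> borel_measurable M" by simp
    show "(\<lambda>n. prob {\<omega> \<in> space M. \<bar>integral\<^sup>L (?\<nu> n \<omega>) \<phi> - integral\<^sup>L (uniform_circle (exp (- c))) \<phi>\<bar> > e}) \<longlonglongrightarrow> 0"
      if "e > 0" for e
      using \<phi> that by (rule conv)
  qed
qed

end
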